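(* Let $\mathcal{C}\subseteq\mathcal{X}$ be locally coherent for the problem of minimizing $f(x)=\mathbb{E}[F(x;\omega)]$ over $x\in\mathcal{X}$. Suppose that: (i) $F(x;\omega)$ is continuously differentiable in $x$ for almost all $\omega\in\Omega$; (ii) there is a finite $V\ge 0$ with $\mathbb{E}[\|\nabla F(x;\omega)\|_*^2]\le V^2$ for all $x\in\mathcal{X}$; (iii) for every $p\in\mathcal{X}$ and every sequence $y_n\in\mathcal{Y}$, $\Phi(p,y_n)\to 0$ whenever $Q(y_n)\to p$. Then there exists an open neighborhood $\mathcal{U}$ of $\mathcal{C}$ such that, for every confidence level $\delta>0$ (with $\mathcal{U}$ independent of $\delta$), the iterates $X_n$ of stochastic mirror descent satisfy $$\mathbb{P}(X_n\text{ converges to }\mathcal{C}\mid X_1\in\mathcal{U})\ge 1-\delta$$ provided that the step-size sequence $\gamma_n$ is small enough, in the sense that $\sum_{n=1}^\infty\gamma_n^2\le\eta$ for a suitable threshold $\eta=\eta(\delta)>0$.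
   Context: $\mathcal{X}$ is a nonempty compact convex subset of a finite-dimensional real vector space $\mathcal{V}$ with norm $\|\cdot\|$; $\mathcal{Y}=\mathcal{V}^*$ is the dual space, $\langle y,x\rangle$ the duality pairing, and $\|y\|_*=\sup\{\langle y,x\rangle:\|x\|\le 1\}$ the dual norm. $(\Omega,\mathcal{F},\mathbb{P})$ is a complete probability space, $F:\mathcal{X}\times\Omega\to\mathbb{R}$ is a stochastic objective, and $f(x)=\mathbb{E}[F(x;\omega)]$. Gradients are taken with respect to $x$ and are elements of $\mathcal{Y}$. Under hypotheses (i) and (ii), $f$ is continuously differentiable with $\nabla f(x)=\mathbb{E}[\nabla F(x;\omega)]$. Neighborhoods are relative to $\mathcal{X}$. Local coherence: let $\mathcal{C}$ be a (nonempty) closed set of local minimizers of $f$, i.e. $f(x)\ge f(x^* )$ for all $x^*\in\mathcal{C}$ and all $x\in\mathcal{X}$ sufficiently close to $\mathcal{C}$. $\mathcal{C}$ is locally coherent if there exists an open neighborhood $U$ of $\mathcal{C}$ such that $\langle\nabla f(x),x-x^*\rangle\ge 0$ for all $x\in U$, $x^*\in\mathcal{C}$, and there exists some $x^*\in\mathcal{C}$ for which equality holds (with $x\in U$) only if $x\in\mathcal{C}$. "$X_n$ converges to $\mathcal{C}$" means $\inf_{x\in\mathcal{C}}\|X_n-x\|\to 0$ as $n\to\infty$. Mirror map: $h:\mathcal{X}\to\mathbb{R}$ is a regularizer, i.e. continuous and $K$-strongly convex for some $K>0$: $h(\tau x+(1-\tau)x')\le\tau h(x)+(1-\tau)h(x')-\tfrac12K\tau(1-\tau)\|x'-x\|^2$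 for all $x,x'\in\mathcal{X}$, $\tau\in[0,1]$. The induced mirror map is $Q:\mathcal{Y}\to\mathcal{X}$, $Q(y)=\arg\max_{x\in\mathcal{X}}\{\langle y,x\rangle-h(x)\}$. The Fenchel coupling is $\Phi(p,y)=h(p)+h^*(y)-\langle y,p\rangle$ for $p\in\mathcal{X}$, $y\in\mathcal{Y}$, where $h^*(y)=\max_{x\in\mathcal{X}}\{\langle y,x\rangle-h(x)\}$. Stochastic mirror descent (SMD): $X_n=Q(Y_n)$, $Y_{n+1}=Y_n-\gamma_n\nabla F(X_n;\omega_n)$, $n=1,2,\dots$, with deterministic initialization $Y_1\in\mathcal{Y}$ (so conditioning on $X_1\in\mathcal{U}$ means that $Y_1$ is such that $Q(Y_1)\in\mathcal{U}$), $\omega_n$ i.i.d. samples distributed according to $\mathbb{P}$, and step-sizes $\gamma_n>0$ satisfying $\sum_n\gamma_n^2<\infty$ and $\sum_n\gamma_n=\infty$. *)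

theory Defs
  imports "HOL-Probability.Probability"
begin

text \<open>
  The ambient space is a type \<open>'v\<close> of class \<open>euclidean_space\<close>, used only as a finite-dimensional
  real vector space with its canonical topology; the norm of the problem is an arbitrary norm
  \<open>N\<close> on it, unrelated to the inner product. Its dual is the type \<open>'v \<Rightarrow>\<^sub>L real\<close>, the pairing is
  application, and the topology of the dual is the canonical one as well.
\<close>

definition vector_norm :: "('v::real_vector \<Rightarrow> real) \<Rightarrow> bool" where
  "vector_norm N \<longleftrightarrow>
     (\<forall>x. 0 \<le> N x) \<and> (\<forall>x. N x = 0 \<longleftrightarrow> x = 0) \<and>
     (\<forall>a x. N (a *\<^sub>R x) = \<bar>a\<bar> * N x) \<and> (\<forall>x y. N (x + y) \<le> N x + N y)"

definition dual_norm :: "('v::real_normed_vector \<Rightarrow> real) \<Rightarrow> ('v \<Rightarrow>\<^sub>L real) \<Rightarrow> real" where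
  "dual_norm N y = (SUP x\<in>{x. N x \<le> 1}. blinfun_apply y x)"

definition norm_dist_to :: "('v::real_vector \<Rightarrow> real) \<Rightarrow> 'v set \<Rightarrow> 'v \<Rightarrow> real" where
  "norm_dist_to N C x = (INF c\<in>C. N (x - c))"

text \<open>
  Differentiability is relative to \<open>X\<close> (one-sided at boundary points). If \<open>X\<close> has empty interior,
  the gradient is determined only up to functionals that vanish on the directions of \<open>X\<close>;
  \<open>g\<close> is then any continuous choice of it.
\<close>

definition C1_with_gradient_on ::
    "'v::real_normed_vector set \<Rightarrow> ('v \<Rightarrow> real) \<Rightarrow> ('v \<Rightarrow> 'v \<Rightarrow>\<^sub>L real) \<Rightarrow> bool" where
  "C1_with_gradient_on X \<phi> g \<longleftrightarrow>
     (\<forall>x\<in>X. (\<phi> has_derivative blinfun_apply (g x)) (at x within X)) \<and> continuous_on X g"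

definition closed_set_of_local_minimizers ::
    "('v::real_normed_vector \<Rightarrow> real) \<Rightarrow> 'v set \<Rightarrow> ('v \<Rightarrow> real) \<Rightarrow> 'v set \<Rightarrow> bool" where
  "closed_set_of_local_minimizers N X f C \<longleftrightarrow>
     C \<noteq> {} \<and> C \<subseteq> X \<and> closed C \<and>
     (\<exists>\<epsilon>>0. \<forall>x\<in>X. norm_dist_to N C x < \<epsilon> \<longrightarrow> (\<forall>c\<in>C. f c \<le> f x))"

text \<open>
  The pairing of the gradient of \<open>f\<close> at \<open>x\<close> with \<open>x - c\<close> is the derivative of \<open>f\<close> at \<open>x\<close> within
  \<open>X\<close> in the direction \<open>x - c\<close>. Since \<open>c\<close> lies in \<open>X\<close>, for convex \<open>X\<close> and differentiable \<open>f\<close>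
  its value does not depend on which derivative within \<open>X\<close> is selected by \<open>frechet_derivative\<close>.
\<close>

definition locally_coherent ::
    "('v::real_normed_vector \<Rightarrow> real) \<Rightarrow> 'v set \<Rightarrow> ('v \<Rightarrow> real) \<Rightarrow> 'v set \<Rightarrow> bool" where
  "locally_coherent N X f C \<longleftrightarrow>
     closed_set_of_local_minimizers N X f C \<and>
     (\<exists>U. openin (top_of_set X) U \<and> C \<subseteq> U \<and>
        (\<forall>x\<in>U. \<forall>c\<in>C. frechet_derivative f (at x within X) (x - c) \<ge> 0) \<and>
        (\<exists>c\<in>C. \<forall>x\<in>U. frechet_derivative f (at x within X) (x - c) = 0 \<longrightarrow> x \<in> C))"

definition strongly_convex_on ::
    "('v::real_vector \<Rightarrow> real) \<Rightarrow> real \<Rightarrow> 'v set \<Rightarrow> ('v \<Rightarrow> real) \<Rightarrow> bool" where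
  "strongly_convex_on N K X h \<longleftrightarrow>
     (\<forall>x\<in>X. \<forall>x'\<in>X. \<forall>\<tau>\<in>{0..1}.
        h (\<tau> *\<^sub>R x + (1 - \<tau>) *\<^sub>R x')
          \<le> \<tau> * h x + (1 - \<tau>) * h x' - K / 2 * \<tau> * (1 - \<tau>) * (N (x' - x))\<^sup>2)"

definition regularizer ::
    "('v::real_normed_vector \<Rightarrow> real) \<Rightarrow> 'v set \<Rightarrow> ('v \<Rightarrow> real) \<Rightarrow> bool" where
  "regularizer N X h \<longleftrightarrow> continuous_on X h \<and> (\<exists>K>0. strongly_convex_on N K X h)"

definition mirror_map ::
    "'v::real_normed_vector set \<Rightarrow> ('v \<Rightarrow> real) \<Rightarrow> ('v \<Rightarrow>\<^sub>L real) \<Rightarrow> 'v" where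
  "mirror_map X h y = arg_max_on (\<lambda>x. blinfun_apply y x - h x) X"

text \<open>For compact \<open>X\<close> and continuous \<open>h\<close> the supremum below is a maximum.\<close>

definition convex_conjugate ::
    "'v::real_normed_vector set \<Rightarrow> ('v \<Rightarrow> real) \<Rightarrow> ('v \<Rightarrow>\<^sub>L real) \<Rightarrow> real" where
  "convex_conjugate X h y = (SUP x\<in>X. blinfun_apply y x - h x)"

definition Fenchel_coupling ::
    "'v::real_normed_vector set \<Rightarrow> ('v \<Rightarrow> real) \<Rightarrow> 'v \<Rightarrow> ('v \<Rightarrow>\<^sub>L real) \<Rightarrow> real" where
  "Fenchel_coupling X h p y = h p + convex_conjugate X h y - blinfun_apply y p"

text \<open>
  Stochastic mirror descent with gradient oracle \<open>G\<close>, step sizes \<open>\<gamma>\<close>, initial dual vector \<open>y1\<close>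
  and sample sequence \<open>w\<close>. All sequences are indexed from \<open>0\<close>, so that index \<open>n\<close> is the
  \<open>(n + 1)\<close>-st term in the customary numbering from \<open>1\<close>.
\<close>

primrec smd_dual ::
    "'v::real_normed_vector set \<Rightarrow> ('v \<Rightarrow> real) \<Rightarrow> ('v \<Rightarrow> 'w \<Rightarrow> 'v \<Rightarrow>\<^sub>L real) \<Rightarrow>
     (nat \<Rightarrow> real) \<Rightarrow> ('v \<Rightarrow>\<^sub>L real) \<Rightarrow> (nat \<Rightarrow> 'w) \<Rightarrow> nat \<Rightarrow> ('v \<Rightarrow>\<^sub>L real)" where
  "smd_dual X h G \<gamma> y1 w 0 = y1"
| "smd_dual X h G \<gamma> y1 w (Suc n) =
     smd_dual X h G \<gamma> y1 w n - \<gamma> n *\<^sub>R G (mirror_map X h (smd_dual X h G \<gamma> y1 w n)) (w n)"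

definition smd_iterate ::
    "'v::real_normed_vector set \<Rightarrow> ('v \<Rightarrow> real) \<Rightarrow> ('v \<Rightarrow> 'w \<Rightarrow> 'v \<Rightarrow>\<^sub>L real) \<Rightarrow>
     (nat \<Rightarrow> real) \<Rightarrow> ('v \<Rightarrow>\<^sub>L real) \<Rightarrow> (nat \<Rightarrow> 'w) \<Rightarrow> nat \<Rightarrow> 'v" where
  "smd_iterate X h G \<gamma> y1 w n = mirror_map X h (smd_dual X h G \<gamma> y1 w n)"

definition iid_samples :: "'m measure \<Rightarrow> 'w measure \<Rightarrow> (nat \<Rightarrow> 'm \<Rightarrow> 'w) \<Rightarrow> bool" where
  "iid_samples M P w \<longleftrightarrow>
     prob_space.indep_vars M (\<lambda>_. P) w UNIV \<and> (\<forall>n. distr M P (w n) = P)"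

end

theory Submission
  imports Defs
begin

text \<open>
  Fix a base point \<open>p\<close> of \<open>C\<close> whose Fenchel coupling with the (deterministic) initial dual vector is
  small. One step of the algorithm changes the coupling by the drift
  \<open>- \<gamma> n * (g (x n) \<bullet> (x n - p))\<close>, a martingale difference, and a term of order
  \<open>(\<gamma> n)\<^sup>2\<close>. By Kolmogorov's maximal inequality and Markov's inequality the last two
  stay below the radius of coherence, forever and with probability at least \<open>1 - \<delta>\<close>, once
  \<open>\<Sum>n. (\<gamma> n)\<^sup>2\<close> is small; so the drift never turns positive and the iterates never leave the
  region of coherence. On this event the drift with respect to the distinguished point \<open>c0\<close> is
  summable, hence a subsequence of the iterates converges to some \<open>l \<in> C\<close>. The coupling with \<open>l\<close> is
  decreasing up to a convergent series and tends to \<open>0\<close> along the subsequence by (iii), so it tends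
  to \<open>0\<close>. The noise series converges almost surely against all of the finitely many basis vectors,
  which makes the argument work for the random point \<open>l\<close>.
\<close>

section \<open>Mirror maps and Fenchel couplings\<close>

text \<open>Coherence concerns the derivative of \<open>f\<close> within \<open>X\<close>, whereas
  the algorithm sees sampled gradients; differentiation under the expectation connects the two.
  These gradients are prescribed only on \<open>X\<close> and regular only off a null set, so a
  version is built that is continuous on the whole space for every sample and can be composed
  measurably with random iterates. Its trajectories agree almost surely with the true ones, so the
  convergence event is evaluated in the completion. The second moment bound holds on all of
  \<open>X\<close>, so the noise is a square integrable martingale whether or not the iterates
  remain near \<open>C\<close>: no stopping time is needed, and confinement is a deterministic
  induction along each good path. Strong convexity turns a coupling below \<open>K * r^2 / 2\<close>
  into a distance below \<open>r\<close>. This budget is split as \<open>K * r^2 / 4\<close> for the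
  start, \<open>K * r^2 / 8\<close> for the noise and \<open>K * r^2 / 8\<close> for the squares.
  The split does not involve \<delta>, so one neighborhood serves all confidence levels and only the
  threshold on the step sizes depends on \<delta>.\<close>

locale mirror_setup =
  fixes X :: "'v::real_normed_vector set" and h :: "'v \<Rightarrow> real" and K :: real
  assumes X_ne: "X \<noteq> {}" and X_compact: "compact X" and X_convex: "convex X"
    and h_cont: "continuous_on X h"
    and K_pos: "K > 0" and h_strong: "strongly_convex_on norm K X h"
begin

lemma mirror_map_is_arg_max:
  "is_arg_max (\<lambda>x. blinfun_apply y x - h x) (\<lambda>x. x \<in> X) (mirror_map X h y)"
proof -
  have "continuous_on X (\<lambda>x. blinfun_apply y x - h x)"
    by (intro continuous_intros h_cont)
  from continuous_attains_sup[OF X_compact X_ne this]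
  have "\<exists>x. is_arg_max (\<lambda>x. blinfun_apply y x - h x) (\<lambda>x. x \<in> X) x"
    unfolding is_arg_max_def by (metis not_le)
  then show ?thesis
    unfolding mirror_map_def arg_max_on_def arg_max_def by (rule someI_ex)
qed

lemma mirror_map_in: "mirror_map X h y \<in> X"
  using mirror_map_is_arg_max[of y] by (simp add: is_arg_max_def)

lemma mirror_map_max:
  "x \<in> X \<Longrightarrow> blinfun_apply y x - h x \<le> blinfun_apply y (mirror_map X h y) - h (mirror_map X h y)"
  using mirror_map_is_arg_max[of y] by (auto simp: is_arg_max_def not_less)

lemma convex_conjugate_eq:
  "convex_conjugate X h y = blinfun_apply y (mirror_map X h y) - h (mirror_map X h y)"
  unfolding convex_conjugate_def
  by (rule cSup_eq_maximum) (use mirror_map_in mirror_map_max in auto)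

text \<open>Maximality of \<open>q\<close> is tested at points \<open>z\<close> on the segment from
  \<open>q\<close> to \<open>x\<close>, where strong convexity gains
  \<open>K / 2 * t * (1 - t)\<close> times the squared distance. Dividing by \<open>t\<close> and
  letting \<open>t\<close> tend to 0 keeps the full factor \<open>K / 2\<close>.\<close>

lemma mirror_map_quadratic_growth:
  assumes x: "x \<in> X"
  shows "blinfun_apply y x - h x
           \<le> convex_conjugate X h y - K / 2 * (norm (x - mirror_map X h y))\<^sup>2"
proof -
  define q where "q = mirror_map X h y"
  have q: "q \<in> X" by (simp add: q_def mirror_map_in)
  have *: "blinfun_apply y x - h x + K / 2 * (1 - t) * (norm (x - q))\<^sup>2 \<le> blinfun_apply y q - h q"
    if t: "t \<in> {0<..<1}" for t
  proof -
    define z where "z = t *\<^sub>R x + (1 - t) *\<^sub>R q"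
    have "z \<in> X"
      unfolding z_def using convexD[OF X_convex x q, of t "1 - t"] t by auto
    then have 1: "blinfun_apply y z - h z \<le> blinfun_apply y q - h q"
      unfolding q_def by (rule mirror_map_max)
    have 2: "h z \<le> t * h x + (1 - t) * h q - K / 2 * t * (1 - t) * (norm (x - q))\<^sup>2"
      using h_strong x q t unfolding strongly_convex_on_def z_def by (auto simp: norm_minus_commute)
    have 3: "blinfun_apply y z = t * blinfun_apply y x + (1 - t) * blinfun_apply y q"
      by (simp add: z_def blinfun.bilinear_simps)
    have "t * (blinfun_apply y x - h x + K / 2 * (1 - t) * (norm (x - q))\<^sup>2)
          \<le> t * (blinfun_apply y q - h q)"
      using 1 2 unfolding 3 by (simp add: algebra_simps)
    with t show ?thesis by simp
  qed
  have "((\<lambda>t. blinfun_apply y x - h x + K / 2 * (1 - t) * (norm (x - q))\<^sup>2) \<longlongrightarrow>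
     blinfun_apply y x - h x + K / 2 * (1 - 0) * (norm (x - q))\<^sup>2) (at_right 0)"
    by (intro tendsto_intros)
  then have "blinfun_apply y x - h x + K / 2 * (1 - 0) * (norm (x - q))\<^sup>2 \<le> blinfun_apply y q - h q"
    by (rule tendsto_upperbound)
       (use * eventually_at_right_real[of 0 "1::real"] in \<open>auto elim: eventually_mono\<close>)
  then show ?thesis by (simp add: convex_conjugate_eq q_def)
qed

text \<open>A small coupling forces the mirror point close to \<open>p\<close>. The converse
  passage, from closeness to a small coupling, is what hypothesis (iii) supplies.\<close>

lemma Fenchel_coupling_ge:
  "p \<in> X \<Longrightarrow> K / 2 * (norm (mirror_map X h y - p))\<^sup>2 \<le> Fenchel_coupling X h p y"
  using mirror_map_quadratic_growth[of p y] by (simp add: Fenchel_coupling_def norm_minus_commute)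

text \<open>The maximizer moves from \<open>?q\<close> to \<open>?q'\<close>. Quadratic growth at
  the old dual vector costs \<open>K / 2 * ?d^2\<close>, which is exactly what Young's inequality
  requires to absorb the pairing of \<open>v\<close> with the displacement; only
  \<open>norm v ^ 2 / (2 * K)\<close> remains.\<close>

lemma Fenchel_coupling_step:
  "Fenchel_coupling X h p (y + v)
     \<le> Fenchel_coupling X h p y + blinfun_apply v (mirror_map X h y - p) + (norm v)\<^sup>2 / (2 * K)"
proof -
  let ?q = "mirror_map X h y" and ?q' = "mirror_map X h (y + v)"
  let ?d = "norm (?q' - ?q)"
  have "blinfun_apply v (?q' - ?q) \<le> norm v * ?d"
    using norm_blinfun[of v "?q' - ?q"] by simp
  also have "\<dots> \<le> (norm v)\<^sup>2 / (2 * K) + K / 2 * ?d\<^sup>2"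
  proof -
    have "(norm v)\<^sup>2 / (2 * K) + K / 2 * ?d\<^sup>2 - norm v * ?d = (norm v - K * ?d)\<^sup>2 / (2 * K)"
      using K_pos by (simp add: power2_eq_square field_simps)
    moreover have "\<dots> \<ge> 0" using K_pos by simp
    ultimately show ?thesis by linarith
  qed
  finally have 1: "blinfun_apply v (?q' - ?q) \<le> (norm v)\<^sup>2 / (2 * K) + K / 2 * ?d\<^sup>2" .
  have 2: "blinfun_apply y ?q' - h ?q' \<le> convex_conjugate X h y - K / 2 * ?d\<^sup>2"
    by (rule mirror_map_quadratic_growth[OF mirror_map_in])
  have "convex_conjugate X h (y + v) = (blinfun_apply y ?q' - h ?q') + blinfun_apply v (?q' - ?q) + blinfun_apply v ?q"
    by (simp add: convex_conjugate_eq blinfun.bilinear_simps)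
  also have "\<dots> \<le> convex_conjugate X h y + (norm v)\<^sup>2 / (2 * K) + blinfun_apply v ?q"
    using 1 2 by linarith
  finally show ?thesis
    by (simp add: Fenchel_coupling_def blinfun.bilinear_simps)
qed

text \<open>Adding the growth inequalities for \<open>y\<close> and \<open>y'\<close>, each tested
  at the other maximizer, cancels both conjugates and all values of \<open>h\<close>. Continuity of
  the mirror map is what later makes the iterates measurable.\<close>

lemma mirror_map_Lipschitz: "norm (mirror_map X h y - mirror_map X h y') \<le> norm (y - y') / K"
proof -
  let ?q = "mirror_map X h y" and ?q' = "mirror_map X h y'"
  let ?d = "norm (?q - ?q')"
  have "K * ?d\<^sup>2 \<le> blinfun_apply (y - y') (?q - ?q')"
    using mirror_map_quadratic_growth[OF mirror_map_in, of y y']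
      mirror_map_quadratic_growth[OF mirror_map_in, of y' y]
    by (simp add: convex_conjugate_eq blinfun.bilinear_simps norm_minus_commute)
  also have "\<dots> \<le> norm (y - y') * ?d"
    using norm_blinfun[of "y - y'" "?q - ?q'"] by simp
  finally have "?d * (K * ?d) \<le> ?d * norm (y - y')" by (simp add: power2_eq_square mult_ac)
  then have "K * ?d \<le> norm (y - y')" by (cases "?d = 0") auto
  with K_pos show ?thesis by (simp add: field_simps)
qed

lemma continuous_on_mirror_map: "continuous_on S (mirror_map X h)"
proof -
  have "(1 / K)-lipschitz_on S (mirror_map X h)"
    using mirror_map_Lipschitz K_pos by (intro lipschitz_onI) (auto simp: dist_norm)
  then show ?thesis by (rule lipschitz_on_continuous_on)
qed

end

section \<open>Norms, duals and derivatives on a Euclidean space\<close>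

text \<open>The upper constant comes from expanding in \<open>Basis\<close>. It makes
  \<open>N\<close> Lipschitz, hence continuous, and the lower constant is then its minimum over the
  Euclidean unit sphere.\<close>

lemma vector_norm_equivalent:
  fixes N :: "'v::euclidean_space \<Rightarrow> real"
  assumes N: "vector_norm N"
  obtains a b where "0 < a" "\<And>x. a * norm x \<le> N x" "0 < b" "\<And>x. N x \<le> b * norm x"
proof -
  have N_nonneg: "0 \<le> N x" and N_zero: "N x = 0 \<longleftrightarrow> x = 0" and N_scale: "N (t *\<^sub>R x) = \<bar>t\<bar> * N x"
    and N_tri: "N (x + y) \<le> N x + N y" for x y t
    using N by (auto simp: vector_norm_def)
  define b where "b = (\<Sum>i\<in>Basis. N i) + 1"
  have b: "0 < b" unfolding b_def by (intro add_nonneg_pos sum_nonneg N_nonneg) simp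
  have N_sum: "N (\<Sum>i\<in>I. u i) \<le> (\<Sum>i\<in>I. N (u i))" if "finite I" for I and u :: "'v \<Rightarrow> 'v"
    using that
  proof induction
    case (insert i I)
    then show ?case using N_tri[of "u i" "\<Sum>i\<in>I. u i"] by simp
  qed (use N_zero[of 0] in simp)
  have upper: "N x \<le> b * norm x" for x
  proof -
    have "N x = N (\<Sum>i\<in>Basis. (x \<bullet> i) *\<^sub>R i)" by (simp add: euclidean_representation)
    also have "\<dots> \<le> (\<Sum>i\<in>Basis. \<bar>x \<bullet> i\<bar> * N i)" using N_sum[OF finite_Basis, of "\<lambda>i. (x \<bullet> i) *\<^sub>R i"] by (simp add: N_scale)
    also have "\<dots> \<le> (\<Sum>i\<in>Basis. norm x * N i)"
      by (intro sum_mono mult_right_mono Basis_le_norm N_nonneg)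
    also have "\<dots> = norm x * (\<Sum>i\<in>Basis. N i)" by (simp add: sum_distrib_left)
    also have "\<dots> \<le> b * norm x" by (simp add: b_def algebra_simps)
    finally show ?thesis .
  qed
  have "b-lipschitz_on UNIV N"
  proof (rule lipschitz_onI)
    fix x y
    have "N x \<le> N y + b * norm (x - y)" using N_tri[of y "x - y"] upper[of "x - y"] by simp
    moreover have "N y \<le> N x + b * norm (x - y)"
      using N_tri[of x "y - x"] upper[of "y - x"] by (simp add: norm_minus_commute)
    ultimately show "dist (N x) (N y) \<le> b * dist x y" by (simp add: dist_real_def dist_norm abs_le_iff)
  qed (use b in simp)
  then have cont: "continuous_on UNIV N" by (rule lipschitz_on_continuous_on)
  have "sphere (0::'v) 1 \<noteq> {}" by simp
  from continuous_attains_inf[OF compact_sphere this continuous_on_subset[OF cont subset_UNIV]]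
  obtain z :: 'v where z: "norm z = 1" "\<And>x. norm x = 1 \<Longrightarrow> N z \<le> N x" by auto
  have lower: "N z * norm x \<le> N x" for x
  proof (cases "x = 0")
    case False
    then have "N z \<le> N ((1 / norm x) *\<^sub>R x)" by (intro z) simp
    with False show ?thesis unfolding N_scale by (simp add: field_simps)
  qed (simp add: N_nonneg)
  have "0 < N z" using N_nonneg[of z] N_zero[of z] z(1) by force
  with b lower upper show thesis using that by blast
qed

text \<open>\<open>dual_norm\<close> is a real supremum and gives upper bounds only once its range
  is known to be bounded; the constant \<open>a\<close> serves this purpose, while \<open>b\<close>
  determines the estimate.\<close>

lemma norm_le_dual_norm:
  fixes N :: "'v::euclidean_space \<Rightarrow> real"
  assumes N: "vector_norm N" and a: "0 < a" "\<And>x. a * norm x \<le> N x" and b: "0 < b" "\<And>x. N x \<le> b * norm x"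
  shows "norm y \<le> b * dual_norm N y"
proof -
  have N_scale: "N (t *\<^sub>R x) = \<bar>t\<bar> * N x" and N_nonneg: "0 \<le> N x" and N_zero: "N x = 0 \<longleftrightarrow> x = 0" for t x
    using N by (auto simp: vector_norm_def)
  have bdd: "bdd_above (blinfun_apply y ` {x. N x \<le> 1})"
  proof (rule bdd_aboveI2)
    fix x assume "x \<in> {x. N x \<le> 1}"
    then have "a * norm x \<le> 1" using a(2)[of x] by simp
    then have "norm x \<le> 1 / a" using a(1) by (simp add: field_simps)
    then have "norm y * norm x \<le> norm y * (1 / a)" by (intro mult_left_mono) auto
    then show "blinfun_apply y x \<le> norm y * (1 / a)" using norm_blinfun[of y x] by simp
  qed
  have up: "blinfun_apply y x \<le> dual_norm N y" if "N x \<le> 1" for x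
    unfolding dual_norm_def by (rule cSUP_upper[OF _ bdd]) (use that in simp)
  have dual_nonneg: "0 \<le> dual_norm N y" using up[of 0] N_zero[of 0] by simp
  have pair: "blinfun_apply y x \<le> dual_norm N y * N x" for x
  proof (cases "x = 0")
    case False
    then have pos: "0 < N x" using N_nonneg[of x] N_zero[of x] by force
    then have "blinfun_apply y ((1 / N x) *\<^sub>R x) \<le> dual_norm N y" by (intro up) (simp add: N_scale)
    with pos show ?thesis by (simp add: blinfun.scaleR_right field_simps)
  qed (use N_zero[of 0] in simp)
  have N_uminus: "N (- x) = N x" for x using N_scale[of "-1" x] by simp
  show ?thesis
  proof (rule norm_blinfun_bound)
    fix x
    have "\<bar>blinfun_apply y x\<bar> \<le> dual_norm N y * N x"
      using pair[of x] pair[of "- x"] by (simp add: N_uminus blinfun.minus_right abs_le_iff)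
    also have "\<dots> \<le> dual_norm N y * (b * norm x)" by (intro mult_left_mono b dual_nonneg)
    finally show "norm (blinfun_apply y x) \<le> b * dual_norm N y * norm x" by (simp add: mult_ac)
  qed (use b dual_nonneg in simp)
qed

lemma norm_dist_to_tendsto_0_iff:
  fixes N :: "'v::euclidean_space \<Rightarrow> real"
  assumes a: "0 < a" "\<And>x. a * norm x \<le> N x" and b: "0 < b" "\<And>x. N x \<le> b * norm x"
    and C: "C \<noteq> {}" "closed C"
  shows "(\<lambda>n. norm_dist_to N C (z n)) \<longlonglongrightarrow> 0 \<longleftrightarrow> (\<lambda>n. infdist (z n) C) \<longlonglongrightarrow> 0"
proof -
  have N_nonneg: "0 \<le> N x" for x
    by (rule order_trans[OF _ a(2)]) (use a(1) in simp)
  have lower: "a * infdist x C \<le> norm_dist_to N C x" for x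
    unfolding norm_dist_to_def
  proof (rule cINF_greatest[OF C(1)])
    fix c assume "c \<in> C"
    then have "a * infdist x C \<le> a * norm (x - c)"
      using infdist_le[of c C x] a(1) by (intro mult_left_mono) (auto simp: dist_norm)
    then show "a * infdist x C \<le> N (x - c)" using a(2)[of "x - c"] by linarith
  qed
  have upper: "norm_dist_to N C x \<le> b * infdist x C" for x
  proof -
    obtain c where c: "c \<in> C" "infdist x C = dist x c" using infdist_attains_inf[OF C(2,1)] by blast
    have "norm_dist_to N C x \<le> N (x - c)"
      unfolding norm_dist_to_def by (rule cINF_lower[OF bdd_belowI2[of _ 0] c(1)]) (rule N_nonneg)
    with b(2)[of "x - c"] c show ?thesis by (simp add: dist_norm)
  qed
  show ?thesis
  proof
    assume "(\<lambda>n. norm_dist_to N C (z n)) \<longlonglongrightarrow> 0"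
    then have lim: "(\<lambda>n. norm_dist_to N C (z n) / a) \<longlonglongrightarrow> 0" by (rule tendsto_divide_zero)
    have "infdist (z n) C \<le> norm_dist_to N C (z n) / a" for n
      using lower[of "z n"] a(1) by (simp add: field_simps)
    then show "(\<lambda>n. infdist (z n) C) \<longlonglongrightarrow> 0"
      by (intro tendsto_sandwich[OF _ _ tendsto_const lim]) (auto simp: infdist_nonneg)
  next
    assume "(\<lambda>n. infdist (z n) C) \<longlonglongrightarrow> 0"
    then have lim: "(\<lambda>n. b * infdist (z n) C) \<longlonglongrightarrow> 0" by (rule tendsto_mult_right_zero)
    have "0 \<le> norm_dist_to N C (z n)" for n
      by (rule order_trans[OF _ lower]) (use a(1) in \<open>simp add: infdist_nonneg\<close>)
    then show "(\<lambda>n. norm_dist_to N C (z n)) \<longlonglongrightarrow> 0"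
      by (intro tendsto_sandwich[OF _ _ tendsto_const lim]) (auto simp: upper)
  qed
qed

text \<open>The Riesz representative with respect to the inner product of the type. It is an
  isometry for the operator norm and allows gradients to be integrated, projected and tested
  coordinatewise as ordinary vectors.\<close>

definition Riesz :: "('v::euclidean_space \<Rightarrow>\<^sub>L real) \<Rightarrow> 'v" where
  "Riesz y = (\<Sum>b\<in>Basis. blinfun_apply y b *\<^sub>R b)"

lemma Riesz_inner: "Riesz y \<bullet> v = blinfun_apply y v"
proof -
  have "blinfun_apply y v = blinfun_apply y (\<Sum>b\<in>Basis. (v \<bullet> b) *\<^sub>R b)"
    by (simp add: euclidean_representation)
  also have "\<dots> = (\<Sum>b\<in>Basis. (v \<bullet> b) * blinfun_apply y b)"
    by (simp add: blinfun.sum_right blinfun.scaleR_right)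
  also have "\<dots> = Riesz y \<bullet> v"
    by (simp add: Riesz_def inner_sum_left inner_commute[of v] mult.commute)
  finally show ?thesis by simp
qed

lemma inner_right_Riesz: "blinfun_inner_right (Riesz y) = y"
  by (rule blinfun_eqI) (simp add: Riesz_inner)

lemma norm_inner_right: "norm (blinfun_inner_right a) = norm (a :: 'v::euclidean_space)"
proof (rule antisym)
  show "norm (blinfun_inner_right a) \<le> norm a"
    by (rule norm_blinfun_bound) (auto simp: Cauchy_Schwarz_ineq2)
  have "norm a * norm a \<le> norm (blinfun_inner_right a) * norm a"
    using norm_blinfun[of "blinfun_inner_right a" a] by (simp add: norm_eq_sqrt_inner)
  then show "norm a \<le> norm (blinfun_inner_right a)" by (cases "a = 0") auto
qed

lemma norm_Riesz: "norm (Riesz y) = norm y"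
  using norm_inner_right[of "Riesz y"] by (simp add: inner_right_Riesz)

lemma continuous_on_Riesz: "continuous_on S Riesz"
  unfolding Riesz_def[abs_def] by (intro continuous_intros)

text \<open>The segment from \<open>x\<close> to \<open>c\<close> stays in \<open>X\<close>, so both
  candidates compute the same one-sided derivative of \<open>f\<close> along it. This reconciles the
  arbitrary choice made by \<open>frechet_derivative\<close> with the mean gradient even if
  \<open>X\<close> has empty interior.\<close>

lemma has_derivative_within_convex_unique:
  fixes f :: "'v::real_normed_vector \<Rightarrow> real"
  assumes D: "(f has_derivative D) (at x within X)" "(f has_derivative D') (at x within X)"
    and X: "convex X" "x \<in> X" "c \<in> X"
  shows "D (x - c) = D' (x - c)"
proof -
  let ?z = "\<lambda>t. x + t *\<^sub>R (c - x)"
  have zX: "?z ` {0..1} \<subseteq> X"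
    using convexD_alt[OF X] by (force simp: algebra_simps)
  have deriv: "((\<lambda>t. f (?z t)) has_vector_derivative E (c - x)) (at 0 within {0..1})"
    if E: "(f has_derivative E) (at x within X)" for E
  proof -
    have "(f has_derivative E) (at (?z 0) within ?z ` {0..1})"
      using has_derivative_subset[OF E zX] by simp
    moreover have "(?z has_derivative (\<lambda>t. t *\<^sub>R (c - x))) (at 0 within {0..1})"
      by (auto intro!: derivative_eq_intros)
    ultimately have "((\<lambda>t. f (?z t)) has_derivative (\<lambda>t. E (t *\<^sub>R (c - x)))) (at 0 within {0..1})"
      by (rule has_derivative_in_compose[rotated])
    then show ?thesis
      by (simp add: has_vector_derivative_def linear_cmul[OF has_derivative_linear[OF E]])
  qed
  have "D (c - x) = D' (c - x)"
    using vector_derivative_unique_within[OF _ deriv[OF D(1)] deriv[OF D(2)]]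
    by (simp add: trivial_limit_within islimpt_Icc)
  moreover have "E (x - c) = - E (c - x)" if "(f has_derivative E) (at x within X)" for E
    using linear_neg[OF has_derivative_linear[OF that], of "c - x"] by simp
  ultimately show ?thesis using D by metis
qed

section \<open>Square integrable martingale differences\<close>

lemma integrable_mult_of_squares:
  fixes f g :: "'a \<Rightarrow> real"
  assumes "f \<in> borel_measurable M" "g \<in> borel_measurable M"
    "integrable M (\<lambda>x. (f x)\<^sup>2)" "integrable M (\<lambda>x. (g x)\<^sup>2)"
  shows "integrable M (\<lambda>x. f x * g x)"
proof (rule Bochner_Integration.integrable_bound[of M "\<lambda>x. (f x)\<^sup>2 + (g x)\<^sup>2"])
  show "AE x in M. norm (f x * g x) \<le> norm ((f x)\<^sup>2 + (g x)\<^sup>2)"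
  proof (rule AE_I2)
    fix x
    have "2 * (\<bar>f x\<bar> * \<bar>g x\<bar>) \<le> \<bar>f x\<bar>\<^sup>2 + \<bar>g x\<bar>\<^sup>2"
      using sum_squares_bound[of "\<bar>f x\<bar>" "\<bar>g x\<bar>"] by simp
    then have "2 * (\<bar>f x\<bar> * \<bar>g x\<bar>) \<le> (f x)\<^sup>2 + (g x)\<^sup>2" by (simp only: power2_abs)
    moreover have "0 \<le> \<bar>f x\<bar> * \<bar>g x\<bar>" by simp
    ultimately have "\<bar>f x\<bar> * \<bar>g x\<bar> \<le> (f x)\<^sup>2 + (g x)\<^sup>2" by linarith
    then show "norm (f x * g x) \<le> norm ((f x)\<^sup>2 + (g x)\<^sup>2)"
      by (simp add: abs_mult)
  qed
qed (use assms in auto)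

text \<open>\<open>F n\<close> is the information available before the increment \<open>d n\<close>
  is drawn. The martingale property is phrased through integrals over past events, the form that
  Fubini's theorem delivers for the algorithm.\<close>

locale martingale_differences = prob_space M for M :: "'a measure" +
  fixes F :: "nat \<Rightarrow> 'a measure" and d :: "nat \<Rightarrow> 'a \<Rightarrow> real"
  assumes subalg: "\<And>n. subalgebra M (F n)"
    and filtration: "\<And>n. subalgebra (F (Suc n)) (F n)"
    and adapted: "\<And>n. d n \<in> borel_measurable (F (Suc n))"
    and square_integrable: "\<And>n. integrable M (\<lambda>x. (d n x)\<^sup>2)"
    and centred: "\<And>n A. A \<in> sets (F n) \<Longrightarrow> (\<integral>x\<in>A. d n x \<partial>M) = 0"
begin

lemma subalgebra_le: "m \<le> n \<Longrightarrow> subalgebra (F n) (F m)"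
proof (induction n rule: dec_induct)
  case base then show ?case by (simp add: subalgebra_def)
next
  case (step n) then show ?case using filtration[of n] by (auto simp: subalgebra_def)
qed

lemma d_measurable [measurable]: "d n \<in> borel_measurable M"
  by (rule measurable_from_subalg[OF subalg adapted])

lemma d_adapted_le: "m < n \<Longrightarrow> d m \<in> borel_measurable (F n)"
  by (rule measurable_from_subalg[OF subalgebra_le adapted]) auto

lemma d_integrable: "integrable M (d n)"
  using integrable_mult_of_squares[of "d n" M "\<lambda>_. 1"] square_integrable by simp

text \<open>By \<open>centred\<close>, the conditional expectation of \<open>d n\<close> given
  \<open>F n\<close> vanishes almost everywhere, and the factor \<open>Z\<close>, known at time
  \<open>n\<close>, can be pulled out of it.\<close>

lemma orthogonal:
  assumes Z: "Z \<in> borel_measurable (F n)" "integrable M (\<lambda>x. (Z x)\<^sup>2)"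
  shows "(\<integral>x. Z x * d n x \<partial>M) = 0"
proof -
  interpret finite_measure_subalgebra M "F n"
    by unfold_locales (rule subalg)
  have [measurable]: "Z \<in> borel_measurable M" by (rule measurable_from_subalg[OF subalg Z(1)])
  have "AE x in M. real_cond_exp M (F n) (d n) x = 0"
    by (rule real_cond_exp_charact) (use centred d_integrable in auto)
  then have "(\<integral>x. Z x * real_cond_exp M (F n) (d n) x \<partial>M) = (\<integral>x. 0 \<partial>M)"
    by (intro integral_cong_AE) auto
  moreover have "(\<integral>x. Z x * real_cond_exp M (F n) (d n) x \<partial>M) = (\<integral>x. Z x * d n x \<partial>M)"
    using Z square_integrable by (intro real_cond_exp_intg integrable_mult_of_squares) auto
  ultimately show ?thesis by simp
qed

abbreviation S :: "nat \<Rightarrow> 'a \<Rightarrow> real" where "S n x \<equiv> \<Sum>k<n. d k x"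

lemma S_adapted: "m \<le> n \<Longrightarrow> S m \<in> borel_measurable (F n)"
  by (intro borel_measurable_sum d_adapted_le) auto

lemma S_square_integrable: "integrable M (\<lambda>x. (S n x)\<^sup>2)"
proof (induction n)
  case (Suc n)
  have "integrable M (\<lambda>x. (S n x)\<^sup>2 + 2 * (S n x * d n x) + (d n x)\<^sup>2)"
    by (intro Bochner_Integration.integrable_add integrable_mult_right integrable_mult_of_squares
        Suc square_integrable) auto
  then show ?case by (simp add: power2_sum algebra_simps)
qed auto

text \<open>Pythagoras localized to a past event: the cross term vanishes because
  \<open>indicator A x * S n x\<close> is still measurable for \<open>F n\<close>. The localization
  gives the submartingale property of the squared sums needed for the maximal inequality.\<close>

lemma S_square_on_step:
  assumes A: "A \<in> sets (F n)"
  shows "(\<integral>x. indicator A x * (S (Suc n) x)\<^sup>2 \<partial>M)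
    = (\<integral>x. indicator A x * (S n x)\<^sup>2 \<partial>M) + (\<integral>x. indicator A x * (d n x)\<^sup>2 \<partial>M)"
proof -
  have [measurable]: "A \<in> sets M" using A subalg by (auto simp: subalgebra_def)
  have int: "integrable M (\<lambda>x. indicator A x * f x)" if "integrable M f" for f :: "'a \<Rightarrow> real"
    using integrable_real_mult_indicator[OF _ that, of A] by (simp add: mult.commute)
  have power2_indicator: "(indicator A x)\<^sup>2 = (indicator A x :: real)" for x
    by (simp add: indicator_def)
  have SA: "(\<lambda>x. indicator A x * S n x) \<in> borel_measurable (F n)"
    using A S_adapted[of n n] by (intro borel_measurable_times borel_measurable_indicator) auto
  have Sq: "integrable M (\<lambda>x. (indicator A x * S n x)\<^sup>2)"
    using int[OF S_square_integrable[of n]]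
    by (simp add: power_mult_distrib power2_indicator)
  have Sd: "integrable M (\<lambda>x. indicator A x * S n x * d n x)"
    by (intro integrable_mult_of_squares[of "\<lambda>x. indicator A x * S n x"] Sq square_integrable) auto
  have "(\<integral>x. indicator A x * (S (Suc n) x)\<^sup>2 \<partial>M) =
    (\<integral>x. indicator A x * (S n x)\<^sup>2 + 2 * (indicator A x * S n x * d n x) + indicator A x * (d n x)\<^sup>2 \<partial>M)"
    by (intro Bochner_Integration.integral_cong) (auto simp: power2_sum algebra_simps)
  also have "\<dots> = (\<integral>x. indicator A x * (S n x)\<^sup>2 \<partial>M) + 2 * (\<integral>x. indicator A x * S n x * d n x \<partial>M)
     + (\<integral>x. indicator A x * (d n x)\<^sup>2 \<partial>M)"
    using int[OF S_square_integrable[of n]] int[OF square_integrable[of n]] Sd by simp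
  also have "(\<integral>x. indicator A x * S n x * d n x \<partial>M) = 0"
    by (rule orthogonal[OF SA Sq])
  finally show ?thesis by simp
qed

lemma S_square_expectation: "expectation (\<lambda>x. (S n x)\<^sup>2) = (\<Sum>k<n. expectation (\<lambda>x. (d k x)\<^sup>2))"
proof (induction n)
  case (Suc n)
  have "space M \<in> sets (F n)" using subalg[of n] sets.top[of "F n"] by (simp add: subalgebra_def)
  from S_square_on_step[OF this] Suc show ?case
    by (simp cong: Bochner_Integration.integral_cong)
qed simp

lemma S_square_on_mono:
  assumes A: "A \<in> sets (F k)" and "k \<le> n"
  shows "(\<integral>x. indicator A x * (S k x)\<^sup>2 \<partial>M) \<le> (\<integral>x. indicator A x * (S n x)\<^sup>2 \<partial>M)"
  using \<open>k \<le> n\<close>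
proof (induction n rule: dec_induct)
  case (step n)
  have "A \<in> sets (F n)" using A subalgebra_le[OF \<open>k \<le> n\<close>] by (auto simp: subalgebra_def)
  moreover have "0 \<le> (\<integral>x. indicator A x * (d n x)\<^sup>2 \<partial>M)" by simp
  ultimately show ?case using S_square_on_step[of A n] step.IH by linarith
qed simp

text \<open>The event is decomposed by the first time the level is reached. On each piece the square
  at that time is at least \<open>a^2\<close>, and the submartingale property passes this bound to
  time \<open>n\<close>; disjointness of the pieces lets the contributions add up to at most the
  full second moment.\<close>

theorem Kolmogorov_maximal:
  assumes a: "a > 0"
  shows "prob {x \<in> space M. \<exists>k\<le>n. a \<le> \<bar>S k x\<bar>} \<le> (\<Sum>k<n. expectation (\<lambda>x. (d k x)\<^sup>2)) / a\<^sup>2"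
proof -
  \<comment> \<open>The event that \<open>k\<close> is the first index with a sum of size at least
    \<open>a\<close>; it is decided by \<open>F k\<close>.\<close>
  define A where "A k = {x \<in> space M. a \<le> \<bar>S k x\<bar> \<and> (\<forall>j<k. \<bar>S j x\<bar> < a)}" for k
  have A_F: "A k \<in> sets (F k)" for k
  proof -
    have [measurable]: "S j \<in> borel_measurable (F k)" if "j \<le> k" for j using that by (rule S_adapted)
    have "{x \<in> space (F k). a \<le> \<bar>S k x\<bar>} \<in> sets (F k)"
      using S_adapted[of k k] by measurable
    moreover have "{x \<in> space (F k). \<bar>S j x\<bar> < a} \<in> sets (F k)" if "j < k" for j
      using S_adapted[of j k] that by (intro borel_measurable_less) auto
    then have "{x \<in> space (F k). \<forall>j\<in>{..<k}. \<bar>S j x\<bar> < a} \<in> sets (F k)"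
      by (intro sets.sets_Collect_finite_All) auto
    ultimately have "{x \<in> space (F k). a \<le> \<bar>S k x\<bar>} \<inter> {x \<in> space (F k). \<forall>j\<in>{..<k}. \<bar>S j x\<bar> < a} \<in> sets (F k)"
      by (rule sets.Int)
    moreover have "{x \<in> space (F k). a \<le> \<bar>S k x\<bar>} \<inter> {x \<in> space (F k). \<forall>j\<in>{..<k}. \<bar>S j x\<bar> < a} = A k"
      using subalg[of k] by (auto simp: A_def subalgebra_def)
    ultimately show ?thesis by simp
  qed
  then have [measurable]: "A k \<in> sets M" for k using subalg[of k] by (auto simp: subalgebra_def)
  have int: "integrable M (\<lambda>x. indicator (A k) x * f x)" if "integrable M f" for f :: "'a \<Rightarrow> real" and k
    using integrable_real_mult_indicator[OF _ that, of "A k"] by (simp add: mult.commute)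
  have disj: "disjoint_family_on A {..n}"
    by (auto simp: disjoint_family_on_def A_def) (metis linorder_neqE_nat not_le)
  have "{x \<in> space M. \<exists>k\<le>n. a \<le> \<bar>S k x\<bar>} = (\<Union>k\<in>{..n}. A k)"
  proof (intro equalityI subsetI)
    fix x assume "x \<in> {x \<in> space M. \<exists>k\<le>n. a \<le> \<bar>S k x\<bar>}"
    then obtain k where k: "x \<in> space M" "k \<le> n" "a \<le> \<bar>S k x\<bar>" by auto
    define l where "l = (LEAST k. a \<le> \<bar>S k x\<bar>)"
    have "a \<le> \<bar>S l x\<bar>" "l \<le> k" unfolding l_def using k by (auto intro: LeastI Least_le)
    moreover have "\<bar>S j x\<bar> < a" if "j < l" for j
      using not_less_Least[of j "\<lambda>k. a \<le> \<bar>S k x\<bar>"] that by (auto simp: l_def)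
    ultimately show "x \<in> (\<Union>k\<in>{..n}. A k)" using k by (auto simp: A_def)
  qed (auto simp: A_def)
  then have "a\<^sup>2 * prob {x \<in> space M. \<exists>k\<le>n. a \<le> \<bar>S k x\<bar>} = (\<Sum>k\<le>n. a\<^sup>2 * prob (A k))"
    using finite_measure_finite_Union[OF _ _ disj] by (simp add: sum_distrib_left image_subset_iff)
  also have "\<dots> \<le> (\<Sum>k\<le>n. \<integral>x. indicator (A k) x * (S n x)\<^sup>2 \<partial>M)"
  proof (rule sum_mono)
    fix k assume "k \<in> {..n}"
    have "a\<^sup>2 * prob (A k) = (\<integral>x. indicator (A k) x * a\<^sup>2 \<partial>M)" by simp
    also have "\<dots> \<le> (\<integral>x. indicator (A k) x * (S k x)\<^sup>2 \<partial>M)"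
    proof (rule integral_mono[OF int int[OF S_square_integrable]])
      fix x assume "x \<in> space M"
      show "indicator (A k) x * a\<^sup>2 \<le> indicator (A k) x * (S k x)\<^sup>2"
        using a by (auto simp: indicator_def A_def abs_le_square_iff[symmetric])
    qed auto
    also have "\<dots> \<le> (\<integral>x. indicator (A k) x * (S n x)\<^sup>2 \<partial>M)"
      using A_F \<open>k \<in> {..n}\<close> by (intro S_square_on_mono) auto
    finally show "a\<^sup>2 * prob (A k) \<le> (\<integral>x. indicator (A k) x * (S n x)\<^sup>2 \<partial>M)" .
  qed
  also have "\<dots> = (\<integral>x. (\<Sum>k\<le>n. indicator (A k) x * (S n x)\<^sup>2) \<partial>M)"
    by (rule Bochner_Integration.integral_sum[symmetric]) (auto intro: int S_square_integrable)
  also have "\<dots> \<le> (\<integral>x. (S n x)\<^sup>2 \<partial>M)"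
  proof (rule integral_mono)
    fix x
    have "(\<Sum>k\<le>n. indicator (A k) x :: real) = indicator (\<Union>k\<in>{..n}. A k) x"
      by (subst indicator_UN_disjoint[OF _ disj]) auto
    then have "(\<Sum>k\<le>n. indicator (A k) x :: real) \<le> 1" by simp
    then show "(\<Sum>k\<le>n. indicator (A k) x * (S n x)\<^sup>2) \<le> (S n x)\<^sup>2"
      unfolding sum_distrib_right[symmetric] by (simp add: mult_left_le_one_le sum_nonneg)
  next
    show "integrable M (\<lambda>x. \<Sum>k\<le>n. indicator (A k) x * (S n x)\<^sup>2)"
      by (intro Bochner_Integration.integrable_sum int S_square_integrable)
  qed (rule S_square_integrable)
  also have "\<dots> = (\<Sum>k<n. expectation (\<lambda>x. (d k x)\<^sup>2))" by (rule S_square_expectation)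
  finally show ?thesis using a by (simp add: field_simps)
qed

theorem Kolmogorov_maximal_infinite:
  assumes a: "a > 0" and sm: "summable (\<lambda>k. expectation (\<lambda>x. (d k x)\<^sup>2))"
  shows "prob {x \<in> space M. \<exists>k. a \<le> \<bar>S k x\<bar>} \<le> (\<Sum>k. expectation (\<lambda>x. (d k x)\<^sup>2)) / a\<^sup>2"
proof -
  define B where "B n = {x \<in> space M. \<exists>k\<le>n. a \<le> \<bar>S k x\<bar>}" for n
  have [measurable]: "B n \<in> events" for n unfolding B_def by measurable
  have "B m \<subseteq> B n" if "m \<le> n" for m n
    unfolding B_def using order_trans[OF _ that] by blast
  then have "range B \<subseteq> events" "incseq B" by (auto simp: incseq_def)
  then have "(\<lambda>n. prob (B n)) \<longlonglongrightarrow> prob (\<Union>n. B n)"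
    by (rule finite_Lim_measure_incseq)
  moreover have "(\<Union>n. B n) = {x \<in> space M. \<exists>k. a \<le> \<bar>S k x\<bar>}" by (auto simp: B_def)
  moreover have "prob (B n) \<le> (\<Sum>k. expectation (\<lambda>x. (d k x)\<^sup>2)) / a\<^sup>2" for n
  proof -
    have "(\<Sum>k<n. expectation (\<lambda>x. (d k x)\<^sup>2)) \<le> (\<Sum>k. expectation (\<lambda>x. (d k x)\<^sup>2))"
      by (rule sum_le_suminf[OF sm]) auto
    then have "(\<Sum>k<n. expectation (\<lambda>x. (d k x)\<^sup>2)) / a\<^sup>2 \<le> (\<Sum>k. expectation (\<lambda>x. (d k x)\<^sup>2)) / a\<^sup>2"
      by (rule divide_right_mono) simp
    with Kolmogorov_maximal[OF a, of n] show ?thesis by (simp add: B_def)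
  qed
  ultimately show ?thesis by (auto intro: LIMSEQ_le_const2)
qed

text \<open>Restarting at time \<open>m\<close> allows the maximal inequality to be applied to the
  tails of the series.\<close>

lemma shift: "martingale_differences M (\<lambda>n. F (m + n)) (\<lambda>n. d (m + n))"
  by unfold_locales (use subalg filtration adapted square_integrable centred in auto)

text \<open>Failure of the Cauchy property at some scale means that every tail oscillates at that
  scale. The maximal inequality bounds the probability for the tail from \<open>m\<close> by a tail
  of the convergent variance series, so the intersection over \<open>m\<close> is a null
  set.\<close>

theorem AE_convergent:
  assumes sm: "summable (\<lambda>k. expectation (\<lambda>x. (d k x)\<^sup>2))"
  shows "AE x in M. convergent (\<lambda>n. S n x)"
proof -
  \<comment> \<open>The tail starting at \<open>m\<close> moves at least \<open>1 / (j + 1)\<close>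
    away from its starting value at some time.\<close>
  define B where "B j m = {x \<in> space M. \<exists>n. inverse (real (Suc j)) \<le> \<bar>\<Sum>k<n. d (m + k) x\<bar>}" for j m
  have [measurable]: "B j m \<in> events" for j m unfolding B_def by measurable
  have bound: "prob (B j m) \<le> (\<Sum>k. expectation (\<lambda>x. (d (k + m) x)\<^sup>2)) / (inverse (real (Suc j)))\<^sup>2" for j m
  proof -
    interpret s: martingale_differences M "\<lambda>n. F (m + n)" "\<lambda>n. d (m + n)" by (rule shift)
    have "summable (\<lambda>k. expectation (\<lambda>x. (d (m + k) x)\<^sup>2))"
      using summable_ignore_initial_segment[OF sm, of m] by (simp add: add.commute)
    from s.Kolmogorov_maximal_infinite[OF _ this, of "inverse (real (Suc j))"]
    show ?thesis by (simp add: B_def add.commute)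
  qed
  have null: "prob (\<Inter>m. B j m) = 0" for j
  proof -
    have "prob (\<Inter>m. B j m) \<le> (\<Sum>k. expectation (\<lambda>x. (d (k + m) x)\<^sup>2)) / (inverse (real (Suc j)))\<^sup>2" for m
      using finite_measure_mono[of "\<Inter>m. B j m" "B j m"] bound[of j m] by (auto intro: order_trans)
    moreover have "(\<lambda>m. (\<Sum>k. expectation (\<lambda>x. (d (k + m) x)\<^sup>2)) / (inverse (real (Suc j)))\<^sup>2) \<longlonglongrightarrow> 0"
      using tendsto_divide[OF suminf_exist_split2[OF sm] tendsto_const[of "(inverse (real (Suc j)))\<^sup>2"]] by simp
    ultimately have "prob (\<Inter>m. B j m) \<le> 0" using LIMSEQ_le_const by blast
    then show ?thesis by (simp add: measure_le_0_iff)
  qed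
  have "AE x in M. x \<notin> (\<Inter>m. B j m)" for j
    by (rule AE_not_in) (simp add: null_sets_def emeasure_eq_measure null)
  then have "AE x in M. \<forall>j. x \<notin> (\<Inter>m. B j m)" by (simp add: AE_all_countable)
  then show ?thesis
  proof (rule AE_mp, intro AE_I2 impI)
    fix x assume x: "x \<in> space M" "\<forall>j. x \<notin> (\<Inter>m. B j m)"
    have "Cauchy (\<lambda>n. S n x)"
    proof (rule metric_CauchyI)
      fix e :: real assume "e > 0"
      then obtain j where j: "inverse (real (Suc j)) < e / 2" using reals_Archimedean[of "e / 2"] by auto
      obtain m where m: "x \<notin> B j m" using x by auto
      have *: "\<bar>S n x - S m x\<bar> < e / 2" if "n \<ge> m" for n
      proof -
        obtain i where i: "n = m + i" using \<open>n \<ge> m\<close> le_Suc_ex by auto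
        have "S n x - S m x = (\<Sum>k<i. d (m + k) x)"
          unfolding i by (induction i) auto
        moreover have "\<bar>\<Sum>k<i. d (m + k) x\<bar> < inverse (real (Suc j))"
          using m x(1) by (auto simp: B_def not_le)
        ultimately show ?thesis using j by linarith
      qed
      show "\<exists>M. \<forall>m\<ge>M. \<forall>n\<ge>M. dist (S m x) (S n x) < e"
      proof (intro exI allI impI)
        fix i n assume "i \<ge> m" "n \<ge> m"
        then show "dist (S i x) (S n x) < e" using *[of i] *[of n] unfolding dist_real_def by linarith
      qed
    qed
    then show "convergent (\<lambda>n. S n x)" by (rule Cauchy_convergent)
  qed
qed

end

section \<open>Histories of i.i.d. samples\<close>

context prob_space
begin

text \<open>The identity map into \<open>F\<close> plays the role of the whole past as a single
  random element; its law is \<open>M\<close> restricted to \<open>F\<close>. Independence on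
  rectangles determines the product law.\<close>

lemma joint_law_eq_pair_measure:
  assumes sub: "subalgebra M F" and w [measurable]: "w \<in> measurable M P"
    and ind: "\<And>A B. A \<in> sets F \<Longrightarrow> B \<in> sets P \<Longrightarrow>
      prob (A \<inter> (w -` B \<inter> space M)) = prob A * prob (w -` B \<inter> space M)"
  shows "distr M F (\<lambda>m. m) \<Otimes>\<^sub>M distr M P w = distr M (F \<Otimes>\<^sub>M P) (\<lambda>m. (m, w m))"
proof -
  have idF [measurable]: "(\<lambda>m. m) \<in> measurable M F" by (rule measurable_from_subalg[OF sub]) simp
  interpret F: prob_space "distr M F (\<lambda>m. m)" by (rule prob_space_distr[OF idF])
  interpret P: prob_space "distr M P w" by (rule prob_space_distr[OF w])
  show ?thesis
  proof (rule pair_measure_eqI)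
    fix A B assume A: "A \<in> sets (distr M F (\<lambda>m. m))" and B: "B \<in> sets (distr M P w)"
    then have [measurable]: "A \<in> sets F" "B \<in> sets P" by auto
    have AM: "A \<in> sets M" "A \<subseteq> space M"
      using A sub sets.sets_into_space[of A F] by (auto simp: subalgebra_def)
    have "(\<lambda>m. (m, w m)) -` (A \<times> B) \<inter> space M = A \<inter> (w -` B \<inter> space M)" "(\<lambda>m. m) -` A \<inter> space M = A"
      using AM by auto
    then show "emeasure (distr M F (\<lambda>m. m)) A * emeasure (distr M P w) B
        = emeasure (distr M (F \<Otimes>\<^sub>M P) (\<lambda>m. (m, w m))) (A \<times> B)"
      using ind[of A B] by (simp add: emeasure_distr emeasure_eq_measure flip: ennreal_mult')
  qed (auto intro!: sets_pair_measure_cong F.sigma_finite_measure_axioms P.sigma_finite_measure_axioms)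
qed

text \<open>The freezing principle: since the past and \<open>w\<close> have a product law, the past
  may be held fixed while the new sample is averaged out by Fubini.\<close>

lemma integral_freezing:
  fixes \<phi> :: "'a \<times> 'w \<Rightarrow> real"
  assumes sub: "subalgebra M F" and w [measurable]: "w \<in> measurable M P"
    and ind: "\<And>A B. A \<in> sets F \<Longrightarrow> B \<in> sets P \<Longrightarrow>
      prob (A \<inter> (w -` B \<inter> space M)) = prob A * prob (w -` B \<inter> space M)"
    and law: "distr M P w = P"
    and \<phi>: "\<phi> \<in> borel_measurable (F \<Otimes>\<^sub>M P)" and int: "integrable M (\<lambda>m. \<phi> (m, w m))"
  shows "(\<integral>m. \<phi> (m, w m) \<partial>M) = (\<integral>m. (\<integral>b. \<phi> (m, b) \<partial>P) \<partial>M)"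
proof -
  let ?F = "distr M F (\<lambda>m. m)"
  have idF [measurable]: "(\<lambda>m. m) \<in> measurable M F" by (rule measurable_from_subalg[OF sub]) simp
  interpret F: prob_space ?F by (rule prob_space_distr[OF idF])
  interpret P: prob_space P using prob_space_distr[OF w] by (simp add: law)
  interpret FP: pair_prob_space ?F P ..
  have joint: "distr M (F \<Otimes>\<^sub>M P) (\<lambda>m. (m, w m)) = ?F \<Otimes>\<^sub>M P"
    using joint_law_eq_pair_measure[OF sub w ind] unfolding law by (rule sym)
  have meas [measurable]: "\<phi> \<in> borel_measurable (?F \<Otimes>\<^sub>M P)"
    using \<phi> by (simp cong: measurable_cong_sets)
  have pair [measurable]: "(\<lambda>m. (m, w m)) \<in> measurable M (F \<Otimes>\<^sub>M P)" by measurable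
  have "integrable (?F \<Otimes>\<^sub>M P) \<phi>"
    unfolding joint[symmetric] using int by (subst integrable_distr_eq) (auto intro: \<phi>)
  then have "(\<integral>x. (\<integral>b. \<phi> (x, b) \<partial>P) \<partial>?F) = integral\<^sup>L (?F \<Otimes>\<^sub>M P) \<phi>"
    by (rule FP.integral_fst'[of "\<phi>"])
  also have "\<dots> = (\<integral>m. \<phi> (m, w m) \<partial>M)"
    unfolding joint[symmetric] by (subst integral_distr) (auto intro: \<phi>)
  also have "(\<integral>x. (\<integral>b. \<phi> (x, b) \<partial>P) \<partial>?F) = (\<integral>m. (\<integral>b. \<phi> (m, b) \<partial>P) \<partial>M)"
    by (subst integral_distr) (auto intro!: P.borel_measurable_lebesgue_integral simp: \<phi>)
  finally show ?thesis by simp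
qed

text \<open>The Tonelli counterpart, used to obtain second moments before any integrability is
  known.\<close>

lemma nn_integral_freezing:
  fixes \<phi> :: "'a \<times> 'w \<Rightarrow> ennreal"
  assumes sub: "subalgebra M F" and w [measurable]: "w \<in> measurable M P"
    and ind: "\<And>A B. A \<in> sets F \<Longrightarrow> B \<in> sets P \<Longrightarrow>
      prob (A \<inter> (w -` B \<inter> space M)) = prob A * prob (w -` B \<inter> space M)"
    and law: "distr M P w = P"
    and \<phi>: "\<phi> \<in> borel_measurable (F \<Otimes>\<^sub>M P)"
  shows "(\<integral>\<^sup>+m. \<phi> (m, w m) \<partial>M) = (\<integral>\<^sup>+m. (\<integral>\<^sup>+b. \<phi> (m, b) \<partial>P) \<partial>M)"
proof -
  let ?F = "distr M F (\<lambda>m. m)"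
  have idF [measurable]: "(\<lambda>m. m) \<in> measurable M F" by (rule measurable_from_subalg[OF sub]) simp
  interpret P: prob_space P using prob_space_distr[OF w] by (simp add: law)
  have joint: "distr M (F \<Otimes>\<^sub>M P) (\<lambda>m. (m, w m)) = ?F \<Otimes>\<^sub>M P"
    using joint_law_eq_pair_measure[OF sub w ind] unfolding law by (rule sym)
  have meas [measurable]: "\<phi> \<in> borel_measurable (?F \<Otimes>\<^sub>M P)"
    using \<phi> by (simp cong: measurable_cong_sets)
  have pair [measurable]: "(\<lambda>m. (m, w m)) \<in> measurable M (F \<Otimes>\<^sub>M P)" by measurable
  have "(\<integral>\<^sup>+m. \<phi> (m, w m) \<partial>M) = integral\<^sup>N (?F \<Otimes>\<^sub>M P) \<phi>"
    unfolding joint[symmetric] by (subst nn_integral_distr) (auto intro: \<phi>)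
  also have "\<dots> = (\<integral>\<^sup>+x. (\<integral>\<^sup>+b. \<phi> (x, b) \<partial>P) \<partial>?F)"
    by (rule P.nn_integral_fst[symmetric]) simp
  also have "\<dots> = (\<integral>\<^sup>+m. (\<integral>\<^sup>+b. \<phi> (m, b) \<partial>P) \<partial>M)"
    by (subst nn_integral_distr) (auto intro!: P.borel_measurable_nn_integral simp: \<phi>)
  finally show ?thesis .
qed

end

text \<open>The sigma-algebra generated by the samples with indices below \<open>n\<close>. Pulling
  back along one map into the product space makes each of its sets an explicit preimage.\<close>

definition history :: "'m measure \<Rightarrow> 'w measure \<Rightarrow> (nat \<Rightarrow> 'm \<Rightarrow> 'w) \<Rightarrow> nat \<Rightarrow> 'm measure" where
  "history M P w n = vimage_algebra (space M) (\<lambda>m. \<lambda>k\<in>{..<n}. w k m) (Pi\<^sub>M {..<n} (\<lambda>_. P))"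

locale iid_sequence = prob_space M for M :: "'m measure" +
  fixes P :: "'w measure" and w :: "nat \<Rightarrow> 'm \<Rightarrow> 'w"
  assumes iid: "iid_samples M P w"
begin

lemma w_measurable [measurable]: "w n \<in> measurable M P"
  using iid by (auto simp: iid_samples_def indep_vars_def)

lemma w_law: "distr M P (w n) = P"
  using iid by (simp add: iid_samples_def)

lemma hist_measurable: "(\<lambda>m. \<lambda>k\<in>{..<n}. w k m) \<in> measurable M (Pi\<^sub>M {..<n} (\<lambda>_. P))"
  by measurable

lemma sets_history:
  "sets (history M P w n) = {(\<lambda>m. \<lambda>k\<in>{..<n}. w k m) -` A \<inter> space M | A. A \<in> sets (Pi\<^sub>M {..<n} (\<lambda>_. P))}"
  unfolding history_def
  by (rule sets_vimage_algebra2) (use measurable_space[OF hist_measurable] in blast)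

lemma space_history: "space (history M P w n) = space M"
  by (simp add: history_def)

lemma subalgebra_history: "subalgebra M (history M P w n)"
  unfolding subalgebra_def sets_history space_history
  using measurable_sets[OF hist_measurable] by blast

lemma hist_measurable_history:
  "(\<lambda>m. \<lambda>k\<in>{..<n}. w k m) \<in> measurable (history M P w n) (Pi\<^sub>M {..<n} (\<lambda>_. P))"
  unfolding history_def
  by (rule measurable_vimage_algebra1) (use measurable_space[OF hist_measurable] in auto)

lemma w_measurable_history: "k < n \<Longrightarrow> w k \<in> measurable (history M P w n) P"
  using measurable_compose[OF hist_measurable_history[of n] measurable_component_singleton[of k "{..<n}"]]
  by auto

lemma history_mono: "subalgebra (history M P w (Suc n)) (history M P w n)"
proof -
  have "(\<lambda>m. \<lambda>k\<in>{..<n}. w k m) \<in> measurable (history M P w (Suc n)) (Pi\<^sub>M {..<n} (\<lambda>_. P))"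
    by (rule measurable_restrict) (rule w_measurable_history, auto)
  from measurable_sets[OF this] show ?thesis
    unfolding subalgebra_def space_history sets_history[of n] by blast
qed

text \<open>The index sets \<open>{..<n}\<close> and \<open>{n}\<close> are disjoint, so the
  corresponding restrictions of the independent family are independent. The last sample enters as an
  element of a one-factor product, and \<open>B'\<close> is the cylinder over \<open>B\<close>
  there.\<close>

lemma indep_history:
  assumes A: "A \<in> sets (history M P w n)" and B: "B \<in> sets P"
  shows "prob (A \<inter> (w n -` B \<inter> space M)) = prob A * prob (w n -` B \<inter> space M)"
proof -
  let ?h = "\<lambda>m. \<lambda>k\<in>{..<n}. w k m" and ?v = "\<lambda>m. \<lambda>k\<in>{n}. w k m"
  have ind: "indep_var (Pi\<^sub>M {..<n} (\<lambda>_. P)) ?h (Pi\<^sub>M {n} (\<lambda>_. P)) ?v"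
    using iid by (intro indep_var_restrict[where I=UNIV]) (auto simp: iid_samples_def)
  obtain A' where A': "A' \<in> sets (Pi\<^sub>M {..<n} (\<lambda>_. P))" "A = ?h -` A' \<inter> space M"
    using A unfolding sets_history by blast
  define B' where "B' = (\<lambda>s. s n) -` B \<inter> space (Pi\<^sub>M {n} (\<lambda>_. P))"
  have "B' \<in> sets (Pi\<^sub>M {n} (\<lambda>_. P))"
    unfolding B'_def using B by measurable
  from indep_varD[OF ind A'(1) this]
  have "prob ((\<lambda>m. (?h m, ?v m)) -` (A' \<times> B') \<inter> space M) = prob A * prob (?v -` B' \<inter> space M)"
    by (simp add: A'(2))
  moreover have v: "?v -` B' \<inter> space M = w n -` B \<inter> space M"
    using measurable_space[OF w_measurable] by (auto simp: B'_def space_PiM)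
  moreover have "(\<lambda>m. (?h m, ?v m)) -` (A' \<times> B') \<inter> space M = A \<inter> (?v -` B' \<inter> space M)"
    by (auto simp: A'(2))
  ultimately show ?thesis by simp
qed

end

section \<open>Stochastic gradients\<close>

lemma LIMSEQ_if_dist_less_inverse:
  fixes x :: "'a::metric_space"
  assumes "\<And>n. dist (z n) x < inverse (real (Suc n))"
  shows "z \<longlonglongrightarrow> x"
proof (rule tendsto_dist_iff[THEN iffD2], rule tendsto_sandwich[OF _ _ tendsto_const LIMSEQ_inverse_real_of_nat])
  show "\<forall>\<^sub>F n in sequentially. dist (z n) x \<le> inverse (real (Suc n))"
    using assms by (intro always_eventually allI less_imp_le)
qed simp

text \<open>Replacing \<open>x\<close> by the first member of a countable dense sequence within
  distance \<open>1 / (n + 1)\<close> gives a function assembled from countably many measurable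
  pieces. By continuity these functions converge pointwise to \<open>f\<close>.\<close>

lemma borel_measurable_Caratheodory:
  fixes f :: "'a::{second_countable_topology, metric_space} \<Rightarrow> 'w \<Rightarrow> 'b::metric_space"
  assumes meas: "\<And>x. f x \<in> borel_measurable P"
    and cont: "\<And>\<omega>. \<omega> \<in> space P \<Longrightarrow> continuous_on UNIV (\<lambda>x. f x \<omega>)"
  shows "(\<lambda>(x, \<omega>). f x \<omega>) \<in> borel_measurable (borel \<Otimes>\<^sub>M P)"
proof -
  obtain D :: "'a set" where D: "countable D" "\<And>U. open U \<Longrightarrow> U \<noteq> {} \<Longrightarrow> \<exists>d\<in>D. d \<in> U"
    using countable_dense_exists by metis
  have "D \<noteq> {}" using D(2)[of UNIV] by auto
  define e where "e = from_nat_into D"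
  define r where "r n x = (LEAST i. dist x (e i) < inverse (real (Suc n)))" for n x
  have r: "dist x (e (r n x)) < inverse (real (Suc n))" for n x
    unfolding r_def
  proof (rule LeastI_ex)
    obtain d where "d \<in> D" "d \<in> ball x (inverse (real (Suc n)))"
      using D(2)[of "ball x (inverse (real (Suc n)))"] by auto
    then show "\<exists>i. dist x (e i) < inverse (real (Suc n))"
      using from_nat_into_surj[OF D(1)] unfolding e_def by (metis mem_ball)
  qed
  have [measurable]: "r n \<in> measurable borel (count_space UNIV)" for n
    unfolding r_def by measurable
  show ?thesis
  proof (rule borel_measurable_LIMSEQ_metric)
    fix n
    have "(\<lambda>p. f (e (r n (fst p))) (snd p)) \<in> borel_measurable (borel \<Otimes>\<^sub>M P)"
    proof (rule measurable_compose_countable[where f = "\<lambda>i p. f (e i) (snd p)"])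
      show "(\<lambda>p. f (e i) (snd p)) \<in> borel_measurable (borel \<Otimes>\<^sub>M P)" for i
        by (rule measurable_compose[OF measurable_snd meas])
    qed measurable
    then show "(\<lambda>p. f (e (r n (fst p))) (snd p)) \<in> borel_measurable (borel \<Otimes>\<^sub>M P)" .
  next
    fix p :: "'a \<times> 'w" assume p: "p \<in> space (borel \<Otimes>\<^sub>M P)"
    obtain x \<omega> where [simp]: "p = (x, \<omega>)" by (cases p)
    have "(\<lambda>n. e (r n x)) \<longlonglongrightarrow> x"
      by (rule LIMSEQ_if_dist_less_inverse) (use r in \<open>simp add: dist_commute\<close>)
    moreover have "\<omega> \<in> space P" using p by (simp add: space_pair_measure)
    ultimately have "(\<lambda>n. f (e (r n x)) \<omega>) \<longlonglongrightarrow> f x \<omega>"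
      using cont by (intro continuous_on_tendsto_compose[of UNIV "\<lambda>x. f x \<omega>"]) auto
    then show "(\<lambda>n. f (e (r n (fst p))) (snd p)) \<longlonglongrightarrow> (case p of (x, \<omega>) \<Rightarrow> f x \<omega>)" by simp
  qed
qed

text \<open>Continuity is required on the whole space and for every sample, so that joint
  measurability holds without exceptional sets. The bound is a nonnegative integral, hence
  integrability is a consequence.\<close>

locale continuous_oracle = P: prob_space P for P :: "'w measure" +
  fixes \<Gamma> :: "'v::euclidean_space \<Rightarrow> 'w \<Rightarrow> 'v" and V :: real
  assumes \<Gamma>_meas: "\<And>x. \<Gamma> x \<in> borel_measurable P"
    and \<Gamma>_cont: "\<And>\<omega>. \<omega> \<in> space P \<Longrightarrow> continuous_on UNIV (\<lambda>x. \<Gamma> x \<omega>)"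
    and V_nonneg: "0 \<le> V"
    and \<Gamma>_square: "\<And>x. (\<integral>\<^sup>+\<omega>. ennreal ((norm (\<Gamma> x \<omega>))\<^sup>2) \<partial>P) \<le> ennreal (V\<^sup>2)"
begin

lemma \<Gamma>_joint [measurable]: "(\<lambda>(x, \<omega>). \<Gamma> x \<omega>) \<in> borel_measurable (borel \<Otimes>\<^sub>M P)"
  by (rule borel_measurable_Caratheodory[OF \<Gamma>_meas \<Gamma>_cont])

lemma \<Gamma>_compose [measurable (raw)]:
  "u \<in> borel_measurable L \<Longrightarrow> v \<in> measurable L P \<Longrightarrow> (\<lambda>m. \<Gamma> (u m) (v m)) \<in> borel_measurable L"
  using measurable_compose[OF measurable_Pair \<Gamma>_joint, of u L v] by simp

lemma \<Gamma>_square_integrable: "integrable P (\<lambda>\<omega>. (norm (\<Gamma> x \<omega>))\<^sup>2)"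
  using \<Gamma>_square[of x] \<Gamma>_meas[of x]
  by (intro integrableI_bounded) (auto intro: le_less_trans)

lemma \<Gamma>_square_integral: "(\<integral>\<omega>. (norm (\<Gamma> x \<omega>))\<^sup>2 \<partial>P) \<le> V\<^sup>2"
proof -
  have "ennreal (\<integral>\<omega>. (norm (\<Gamma> x \<omega>))\<^sup>2 \<partial>P) \<le> ennreal (V\<^sup>2)"
    using \<Gamma>_square[of x] nn_integral_eq_integral[OF \<Gamma>_square_integrable, of x] by simp
  then show ?thesis by (simp add: ennreal_le_iff)
qed

lemma \<Gamma>_integrable: "integrable P (\<Gamma> x)"
proof (rule Bochner_Integration.integrable_bound[of P "\<lambda>\<omega>. 1 + (norm (\<Gamma> x \<omega>))\<^sup>2"])
  show "AE \<omega> in P. norm (\<Gamma> x \<omega>) \<le> norm (1 + (norm (\<Gamma> x \<omega>))\<^sup>2)"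
  proof (rule AE_I2)
    fix \<omega>
    have "0 \<le> (norm (\<Gamma> x \<omega>) - 1)\<^sup>2 + norm (\<Gamma> x \<omega>)" by simp
    then show "norm (\<Gamma> x \<omega>) \<le> norm (1 + (norm (\<Gamma> x \<omega>))\<^sup>2)"
      by (simp add: power2_eq_square algebra_simps)
  qed
qed (use \<Gamma>_square_integrable \<Gamma>_meas in auto)

section \<open>The mean gradient: continuity, size and relation to \<open>f\<close>\<close>

definition g :: "'v \<Rightarrow> 'v" where "g x = (\<integral>\<omega>. \<Gamma> x \<omega> \<partial>P)"

lemma g_inner: "g x \<bullet> v = (\<integral>\<omega>. \<Gamma> x \<omega> \<bullet> v \<partial>P)"
  unfolding g_def by (rule integral_inner_left[symmetric]) (use \<Gamma>_integrable in auto)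

text \<open>
  Truncating at level \<open>R\<close> leaves an error of at most \<open>4 V\<^sup>2 / R\<close> by the second moment bound;
  the truncated part converges by dominated convergence.
\<close>

lemma L1_continuous:
  assumes z: "z \<longlonglongrightarrow> x"
  shows "(\<lambda>n. \<integral>\<omega>. norm (\<Gamma> (z n) \<omega> - \<Gamma> x \<omega>) \<partial>P) \<longlonglongrightarrow> 0"
proof (rule LIMSEQ_I)
  fix e :: real assume e: "e > 0"
  \<comment> \<open>Chosen so that the truncation error \<open>4 * V^2 / R\<close> is at most
    \<open>e / 2\<close>; the added 1 keeps \<open>R\<close> positive when \<open>V\<close> is
    0.\<close>
  define R where "R = 8 * (V\<^sup>2 + 1) / e"
  have R: "R > 0" using e by (simp add: R_def add_nonneg_pos)
  let ?D = "\<lambda>n \<omega>. norm (\<Gamma> (z n) \<omega> - \<Gamma> x \<omega>)"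
  have D_int: "integrable P (?D n)" for n
    by (intro integrable_norm Bochner_Integration.integrable_diff \<Gamma>_integrable)
  have "(\<lambda>n. \<integral>\<omega>. min R (?D n \<omega>) \<partial>P) \<longlonglongrightarrow> (\<integral>\<omega>. 0 \<partial>P)"
  proof (rule integral_dominated_convergence[where w = "\<lambda>_. R"])
    show "AE \<omega> in P. (\<lambda>n. min R (?D n \<omega>)) \<longlonglongrightarrow> 0"
    proof (rule AE_I2)
      fix \<omega> assume "\<omega> \<in> space P"
      then have "(\<lambda>n. \<Gamma> (z n) \<omega>) \<longlonglongrightarrow> \<Gamma> x \<omega>"
        using \<Gamma>_cont z by (intro continuous_on_tendsto_compose[of UNIV "\<lambda>x. \<Gamma> x \<omega>"]) auto
      then have "(\<lambda>n. min R (?D n \<omega>)) \<longlonglongrightarrow> min R (norm (\<Gamma> x \<omega> - \<Gamma> x \<omega>))"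
        by (intro tendsto_intros)
      then show "(\<lambda>n. min R (?D n \<omega>)) \<longlonglongrightarrow> 0" using R by simp
    qed
  qed (use R \<Gamma>_meas in \<open>auto simp: min_def\<close>)
  then have "(\<lambda>n. \<integral>\<omega>. min R (?D n \<omega>) \<partial>P) \<longlonglongrightarrow> 0" by simp
  from LIMSEQ_D[OF this, of "e / 2"] e
  obtain n0 where n0: "\<And>n. n \<ge> n0 \<Longrightarrow> \<bar>\<integral>\<omega>. min R (?D n \<omega>) \<partial>P\<bar> < e / 2"
    unfolding real_norm_def diff_zero by (meson half_gt_zero)
  have "\<bar>\<integral>\<omega>. ?D n \<omega> \<partial>P\<bar> < e" if n: "n \<ge> n0" for n
  proof -
    have min_int: "integrable P (\<lambda>\<omega>. min R (?D n \<omega>))"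
      using R by (intro P.integrable_const_bound[where B = R]) (auto simp: \<Gamma>_meas)
    have "(\<integral>\<omega>. ?D n \<omega> \<partial>P) \<le> (\<integral>\<omega>. min R (?D n \<omega>) + (2 * (norm (\<Gamma> (z n) \<omega>))\<^sup>2 + 2 * (norm (\<Gamma> x \<omega>))\<^sup>2) / R \<partial>P)"
    proof (rule integral_mono[OF D_int])
      show "integrable P (\<lambda>\<omega>. min R (?D n \<omega>) + (2 * (norm (\<Gamma> (z n) \<omega>))\<^sup>2 + 2 * (norm (\<Gamma> x \<omega>))\<^sup>2) / R)"
        using \<Gamma>_square_integrable min_int by auto
    next
      fix \<omega>
      have "(?D n \<omega>)\<^sup>2 \<le> (norm (\<Gamma> (z n) \<omega>) + norm (\<Gamma> x \<omega>))\<^sup>2"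
        by (intro power_mono norm_triangle_ineq4) auto
      also have "\<dots> \<le> 2 * (norm (\<Gamma> (z n) \<omega>))\<^sup>2 + 2 * (norm (\<Gamma> x \<omega>))\<^sup>2"
        using sum_squares_bound[of "norm (\<Gamma> (z n) \<omega>)" "norm (\<Gamma> x \<omega>)"] by (simp add: power2_sum)
      finally have sq: "(?D n \<omega>)\<^sup>2 \<le> 2 * (norm (\<Gamma> (z n) \<omega>))\<^sup>2 + 2 * (norm (\<Gamma> x \<omega>))\<^sup>2" .
      have "?D n \<omega> \<le> min R (?D n \<omega>) + (?D n \<omega>)\<^sup>2 / R"
      proof (cases "?D n \<omega> \<le> R")
        case False
        then have "?D n \<omega> * R \<le> ?D n \<omega> * ?D n \<omega>" by (intro mult_left_mono) auto
        then have "?D n \<omega> \<le> (?D n \<omega>)\<^sup>2 / R" using R by (simp add: pos_le_divide_eq power2_eq_square)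
        then show ?thesis using R False by simp
      qed (use R in simp)
      also have "\<dots> \<le> min R (?D n \<omega>) + (2 * (norm (\<Gamma> (z n) \<omega>))\<^sup>2 + 2 * (norm (\<Gamma> x \<omega>))\<^sup>2) / R"
        using sq R by (intro add_left_mono divide_right_mono) auto
      finally show "?D n \<omega> \<le> min R (?D n \<omega>) + (2 * (norm (\<Gamma> (z n) \<omega>))\<^sup>2 + 2 * (norm (\<Gamma> x \<omega>))\<^sup>2) / R" .
    qed
    also have "\<dots> = (\<integral>\<omega>. min R (?D n \<omega>) \<partial>P) + (2 * (\<integral>\<omega>. (norm (\<Gamma> (z n) \<omega>))\<^sup>2 \<partial>P) + 2 * (\<integral>\<omega>. (norm (\<Gamma> x \<omega>))\<^sup>2 \<partial>P)) / R"
      using \<Gamma>_square_integrable min_int by simp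
    also have "\<dots> \<le> (\<integral>\<omega>. min R (?D n \<omega>) \<partial>P) + (2 * V\<^sup>2 + 2 * V\<^sup>2) / R"
      using \<Gamma>_square_integral[of x] \<Gamma>_square_integral[of "z n"] R by (intro add_left_mono divide_right_mono) auto
    also have "(2 * V\<^sup>2 + 2 * V\<^sup>2) / R \<le> e / 2"
      using e R by (simp add: R_def field_simps add_nonneg_pos)
    finally have "(\<integral>\<omega>. ?D n \<omega> \<partial>P) < e" using n0[OF n] by linarith
    moreover have "(\<integral>\<omega>. ?D n \<omega> \<partial>P) \<ge> 0" by simp
    ultimately show ?thesis by linarith
  qed
  then show "\<exists>n0. \<forall>n\<ge>n0. norm ((\<integral>\<omega>. ?D n \<omega> \<partial>P) - 0) < e" by auto
qed

lemma continuous_on_g: "continuous_on UNIV g"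
proof -
  have "(\<lambda>n. g (z n)) \<longlonglongrightarrow> g x" if "z \<longlonglongrightarrow> x" for z x
  proof -
    have "norm (g (z n) - g x) \<le> (\<integral>\<omega>. norm (\<Gamma> (z n) \<omega> - \<Gamma> x \<omega>) \<partial>P)" for n
      unfolding g_def
      by (subst Bochner_Integration.integral_diff[symmetric]) (auto intro: \<Gamma>_integrable)
    then have "(\<lambda>n. g (z n) - g x) \<longlonglongrightarrow> 0"
      by (intro Lim_null_comparison[OF _ L1_continuous[OF that]]) auto
    then show ?thesis by (simp add: LIM_zero_iff)
  qed
  then show ?thesis by (auto simp: continuous_on_sequentially comp_def)
qed

lemma g_measurable [measurable]: "g \<in> borel_measurable borel"
  by (rule borel_measurable_continuous_onI[OF continuous_on_g])

text \<open>The variance of the oracle is nonnegative, so the squared norm of its mean is at most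
  its second moment.\<close>

lemma norm_g_le: "norm (g x) \<le> V"
proof -
  have "0 \<le> (\<integral>\<omega>. (norm (\<Gamma> x \<omega> - g x))\<^sup>2 \<partial>P)" by simp
  also have "\<dots> = (\<integral>\<omega>. (norm (\<Gamma> x \<omega>))\<^sup>2 - 2 * (\<Gamma> x \<omega> \<bullet> g x) + (norm (g x))\<^sup>2 \<partial>P)"
    by (simp add: power2_norm_eq_inner inner_diff_left inner_diff_right inner_commute algebra_simps)
  also have "\<dots> = (\<integral>\<omega>. (norm (\<Gamma> x \<omega>))\<^sup>2 \<partial>P) - 2 * (g x \<bullet> g x) + (norm (g x))\<^sup>2"
    using \<Gamma>_square_integrable[of x] \<Gamma>_integrable[of x] by (simp add: g_inner P.prob_space)
  also have "\<dots> \<le> V\<^sup>2 - (norm (g x))\<^sup>2"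
    using \<Gamma>_square_integral[of x] by (simp add: power2_norm_eq_inner)
  finally have "(norm (g x))\<^sup>2 \<le> V\<^sup>2" by simp
  then show ?thesis using V_nonneg by (rule power2_le_imp_le)
qed

text \<open>
  The remainder at \<open>x'\<close> is at most \<open>norm (x' - x)\<close> times the supremum over the segment of the
  \<open>L\<^sup>1\<close>-distance between the gradients; this uses the fundamental theorem of calculus along the
  segment and Tonelli.
\<close>

lemma expectation_has_derivative:
  assumes X: "convex X" "x \<in> X"
    and F_int: "\<And>x. x \<in> X \<Longrightarrow> integrable P (F x)"
    and f: "\<And>x. x \<in> X \<Longrightarrow> f x = (\<integral>\<omega>. F x \<omega> \<partial>P)"
    and F_deriv: "AE \<omega> in P. \<forall>x\<in>X. ((\<lambda>x. F x \<omega>) has_derivative (\<lambda>v. \<Gamma> x \<omega> \<bullet> v)) (at x within X)"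
  shows "(f has_derivative (\<lambda>v. g x \<bullet> v)) (at x within X)"
proof -
  define D where "D y = (\<integral>\<omega>. norm (\<Gamma> y \<omega> - \<Gamma> x \<omega>) \<partial>P)" for y
  have D: "\<exists>r>0. \<forall>y. dist y x < r \<longrightarrow> D y < e" if "e > 0" for e
  \<comment> \<open>\<open>L1_continuous\<close> speaks of sequences; a sequence of counterexamples
    converging to \<open>x\<close> converts it into a uniform radius.\<close>
  proof (rule ccontr)
    assume "\<not> ?thesis"
    then have "\<forall>n. \<exists>y. dist y x < inverse (real (Suc n)) \<and> \<not> D y < e"
      by (metis inverse_positive_iff_positive of_nat_0_less_iff zero_less_Suc)
    then obtain z where z: "\<And>n. dist (z n) x < inverse (real (Suc n))" "\<And>n. \<not> D (z n) < e" by metis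
    have "z \<longlonglongrightarrow> x" by (rule LIMSEQ_if_dist_less_inverse) (rule z(1))
    then have "(\<lambda>n. D (z n)) \<longlonglongrightarrow> 0" unfolding D_def by (rule L1_continuous)
    then have "eventually (\<lambda>n. D (z n) < e) sequentially" using \<open>e > 0\<close> by (rule order_tendstoD)
    then show False using z(2) by simp
  qed
  have remainder: "\<bar>f x' - f x - g x \<bullet> (x' - x)\<bar> \<le> norm (x' - x) * b"
    if x': "x' \<in> X" and b: "\<And>s. s \<in> {0..1} \<Longrightarrow> D (x + s *\<^sub>R (x' - x)) \<le> b" "0 \<le> b" for x' b
  proof -
    let ?z = "\<lambda>s. x + s *\<^sub>R (x' - x)"
    have zX: "?z s \<in> X" if "s \<in> {0..1}" for s
      using convexD_alt[OF X(1,2) x', of s] that by (simp add: algebra_simps)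
    let ?R = "\<lambda>\<omega>. F x' \<omega> - F x \<omega> - \<Gamma> x \<omega> \<bullet> (x' - x)"
    have R_int: "integrable P ?R"
      using F_int[OF x'] F_int[OF X(2)] \<Gamma>_integrable[of x] by auto
    have "f x' - f x - g x \<bullet> (x' - x) = (\<integral>\<omega>. ?R \<omega> \<partial>P)"
      using F_int[OF x'] F_int[OF X(2)] \<Gamma>_integrable[of x] by (simp add: f x' X(2) g_inner)
    then have "ennreal \<bar>f x' - f x - g x \<bullet> (x' - x)\<bar> \<le> (\<integral>\<^sup>+\<omega>. ennreal \<bar>?R \<omega>\<bar> \<partial>P)"
      using integral_norm_bound_ennreal[OF R_int] by simp
    also have "\<dots> \<le> (\<integral>\<^sup>+\<omega>. (\<integral>\<^sup>+s. ennreal (norm (\<Gamma> (?z s) \<omega> - \<Gamma> x \<omega>) * norm (x' - x)) * indicator {0..1} s \<partial>lborel) \<partial>P)"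
    proof (rule nn_integral_mono_AE, use F_deriv AE_space in eventually_elim)
      case (elim \<omega>)
      \<comment> \<open>Subtracting the linear part makes the increment of \<open>?\<phi>\<close>
        over the unit interval equal to the remainder \<open>?R \<omega>\<close>.\<close>
      let ?\<phi> = "\<lambda>s. F (?z s) \<omega> - s * (\<Gamma> x \<omega> \<bullet> (x' - x))"
      let ?\<phi>' = "\<lambda>s. (\<Gamma> (?z s) \<omega> - \<Gamma> x \<omega>) \<bullet> (x' - x)"
      let ?k = "\<lambda>s. norm (\<Gamma> (?z s) \<omega> - \<Gamma> x \<omega>) * norm (x' - x)"
      have cont: "continuous_on {0..1} (\<lambda>s. \<Gamma> (?z s) \<omega>)"
        by (rule continuous_on_compose2[OF \<Gamma>_cont[OF elim(2)]]) (auto intro!: continuous_intros)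
      have "(?\<phi>' has_integral ?\<phi> 1 - ?\<phi> 0) {0..1}"
      proof (rule fundamental_theorem_of_calculus)
        fix s :: real assume s: "s \<in> {0..1}"
        have "((\<lambda>x. F x \<omega>) has_derivative (\<lambda>v. \<Gamma> (?z s) \<omega> \<bullet> v)) (at (?z s) within ?z ` {0..1})"
          using elim(1) zX s by (blast intro: has_derivative_subset)
        moreover have "(?z has_derivative (\<lambda>t. t *\<^sub>R (x' - x))) (at s within {0..1})"
          by (auto intro!: derivative_eq_intros)
        ultimately have "((\<lambda>s. F (?z s) \<omega>) has_derivative (\<lambda>t. \<Gamma> (?z s) \<omega> \<bullet> (t *\<^sub>R (x' - x)))) (at s within {0..1})"
          by (rule has_derivative_in_compose[rotated])
        then have "(?\<phi> has_derivative (\<lambda>t. \<Gamma> (?z s) \<omega> \<bullet> (t *\<^sub>R (x' - x)) - t * (\<Gamma> x \<omega> \<bullet> (x' - x)))) (at s within {0..1})"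
          by (intro has_derivative_diff has_derivative_mult_left has_derivative_ident)
        then show "(?\<phi> has_vector_derivative ?\<phi>' s) (at s within {0..1})"
          by (simp add: has_vector_derivative_def inner_diff_left algebra_simps)
      qed simp
      moreover have k_int: "?k integrable_on {0..1}"
        by (intro integrable_continuous_interval continuous_intros cont)
      ultimately have "norm (integral {0..1} ?\<phi>') \<le> integral {0..1} ?k"
        by (intro Henstock_Kurzweil_Integration.integral_norm_bound_integral) (auto simp: Cauchy_Schwarz_ineq2)
      moreover have "integral {0..1} ?\<phi>' = ?R \<omega>"
        using \<open>(?\<phi>' has_integral ?\<phi> 1 - ?\<phi> 0) {0..1}\<close> by (simp add: integral_unique)
      moreover have "(\<integral>\<^sup>+s. ennreal (?k s) * indicator {0..1} s \<partial>lborel) = ennreal (integral {0..1} ?k)"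
        using nn_integral_has_integral_lebesgue[OF _ integrable_integral[OF k_int]]
        by (simp add: ennreal_mult' ennreal_indicator mult.commute)
      ultimately show ?case by (simp add: ennreal_leI)
    qed
    also have "\<dots> = (\<integral>\<^sup>+s. (\<integral>\<^sup>+\<omega>. ennreal (norm (\<Gamma> (?z s) \<omega> - \<Gamma> x \<omega>) * norm (x' - x)) * indicator {0..1} s \<partial>P) \<partial>lborel)"
    proof -
      interpret PL: pair_sigma_finite P lborel ..
      show ?thesis
        by (rule PL.Fubini'[symmetric]) measurable
    qed
    also have "\<dots> \<le> (\<integral>\<^sup>+s. ennreal (norm (x' - x) * b) * indicator {0..1} s \<partial>(lborel :: real measure))"
    proof (rule nn_integral_mono)
      fix s :: real
      have "(\<integral>\<^sup>+\<omega>. ennreal (norm (\<Gamma> (?z s) \<omega> - \<Gamma> x \<omega>) * norm (x' - x)) \<partial>P) = ennreal (D (?z s) * norm (x' - x))"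
        unfolding D_def by (subst nn_integral_eq_integral) (auto intro!: \<Gamma>_integrable)
      also have "\<dots> \<le> ennreal (norm (x' - x) * b)" if "s \<in> {0..1}"
        using b(1)[OF that] by (intro ennreal_leI) (simp add: mult.commute[of b] mult.commute[of "D (?z s)"] mult_left_mono)
      finally show "(\<integral>\<^sup>+\<omega>. ennreal (norm (\<Gamma> (?z s) \<omega> - \<Gamma> x \<omega>) * norm (x' - x)) * indicator {0..1} s \<partial>P)
          \<le> ennreal (norm (x' - x) * b) * indicator {0..1} s"
        by (auto simp: indicator_def)
    qed
    also have "\<dots> = ennreal (norm (x' - x) * b)" by (simp add: nn_integral_cmult_indicator)
    finally show ?thesis using b by (simp add: ennreal_le_iff)
  qed
  show ?thesis
    unfolding has_derivative_within_alt
  proof (intro conjI allI impI)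
    show "bounded_linear (\<lambda>v. g x \<bullet> v)" by (rule bounded_linear_inner_right)
    fix e :: real assume "e > 0"
    then obtain r where r: "r > 0" "\<And>y. dist y x < r \<Longrightarrow> D y < e" using D by blast
    show "\<exists>r>0. \<forall>y\<in>X. norm (y - x) < r \<longrightarrow> norm (f y - f x - g x \<bullet> (y - x)) \<le> e * norm (y - x)"
    proof (intro exI conjI ballI impI, rule r(1))
      fix y assume y: "y \<in> X" "norm (y - x) < r"
      have "D (x + s *\<^sub>R (y - x)) \<le> e" if "s \<in> {0..1}" for s
      proof -
        have "\<bar>s\<bar> * norm (y - x) \<le> 1 * norm (y - x)" using that by (intro mult_right_mono) auto
        with y have "dist (x + s *\<^sub>R (y - x)) x < r" by (simp add: dist_norm)
        then show ?thesis using r(2) less_imp_le by blast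
      qed
      from remainder[OF y(1) this] \<open>e > 0\<close>
      show "norm (f y - f x - g x \<bullet> (y - x)) \<le> e * norm (y - x)" by (simp add: mult.commute)
    qed
  qed
qed

end

section \<open>Trajectories near a coherent set\<close>

text \<open>The deterministic data of the problem, with dual vectors represented by elements of the
  space. Coherence is imposed on the closed condition \<open>infdist x C \<le> r\<close>, so that
  limit points of the iterates are still covered by it.\<close>

locale coherent_mirror_geometry =
  fixes X C :: "'v::euclidean_space set" and Q :: "'v \<Rightarrow> 'v" and \<Phi> :: "'v \<Rightarrow> 'v \<Rightarrow> real"
    and K :: real and g :: "'v \<Rightarrow> 'v" and r :: real and c0 :: 'v
  assumes X_compact: "compact X" and Q_in: "\<And>a. Q a \<in> X" and K_pos: "0 < K"
    and \<Phi>_ge: "\<And>p a. p \<in> X \<Longrightarrow> K / 2 * (norm (Q a - p))\<^sup>2 \<le> \<Phi> p a"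
    and \<Phi>_step: "\<And>p a v. p \<in> X \<Longrightarrow> \<Phi> p (a + v) \<le> \<Phi> p a + v \<bullet> (Q a - p) + (norm v)\<^sup>2 / (2 * K)"
    and \<Phi>_reciprocity: "\<And>p a. p \<in> X \<Longrightarrow> (\<lambda>n. Q (a n)) \<longlonglongrightarrow> p \<Longrightarrow> (\<lambda>n. \<Phi> p (a n)) \<longlonglongrightarrow> 0"
    and g_cont: "continuous_on X g"
    and C_sub: "C \<subseteq> X" and C_closed: "closed C" and c0: "c0 \<in> C"
    and r_pos: "0 < r"
    and coherent: "\<And>x c. x \<in> X \<Longrightarrow> infdist x C \<le> r \<Longrightarrow> c \<in> C \<Longrightarrow> 0 \<le> g x \<bullet> (x - c)"
    and coherent_c0: "\<And>x. x \<in> X \<Longrightarrow> infdist x C \<le> r \<Longrightarrow> g x \<bullet> (x - c0) = 0 \<Longrightarrow> x \<in> C"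
begin

lemma \<Phi>_nonneg: "p \<in> X \<Longrightarrow> 0 \<le> \<Phi> p a"
  by (rule order_trans[OF _ \<Phi>_ge]) (use K_pos in auto)

text \<open>Condition (iii) concerns a single point and a convergent sequence; compactness makes it
  uniform. If it failed, the mirror points of the counterexamples would accumulate at some
  \<open>l\<close> in \<open>C\<close>, where (iii) makes the coupling small. The radius
  \<open>d\<close> later defines the neighborhood of the theorem.\<close>

lemma \<Phi>_small_near:
  assumes "e > 0"
  shows "\<exists>d>0. \<forall>a. infdist (Q a) C < d \<longrightarrow> (\<exists>p\<in>C. \<Phi> p a < e)"
proof (rule ccontr)
  assume contra: "\<not> ?thesis"
  have "\<exists>a. infdist (Q a) C < inverse (real (Suc n)) \<and> (\<forall>p\<in>C. e \<le> \<Phi> p a)" for n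
  proof -
    have "\<not> (\<forall>a. infdist (Q a) C < inverse (real (Suc n)) \<longrightarrow> (\<exists>p\<in>C. \<Phi> p a < e))"
    proof
      assume "\<forall>a. infdist (Q a) C < inverse (real (Suc n)) \<longrightarrow> (\<exists>p\<in>C. \<Phi> p a < e)"
      then have "\<exists>d>0. \<forall>a. infdist (Q a) C < d \<longrightarrow> (\<exists>p\<in>C. \<Phi> p a < e)"
        by (intro exI[of _ "inverse (real (Suc n))"]) simp
      with contra show False by contradiction
    qed
    then show ?thesis by (auto simp: not_less)
  qed
  then obtain a where a: "\<And>n. infdist (Q (a n)) C < inverse (real (Suc n))"
    "\<And>n p. p \<in> C \<Longrightarrow> e \<le> \<Phi> p (a n)" by metis
  obtain l t where l: "l \<in> X" "strict_mono t" "(\<lambda>n. Q (a (t n))) \<longlonglongrightarrow> l"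
    using X_compact[unfolded compact_def, rule_format, of "\<lambda>n. Q (a n)"] Q_in by (auto simp: comp_def)
  have "(\<lambda>n. infdist (Q (a n)) C) \<longlonglongrightarrow> 0"
    by (rule LIMSEQ_if_dist_less_inverse) (use a(1) in \<open>simp add: dist_real_def infdist_nonneg\<close>)
  then have "(\<lambda>n. infdist (Q (a (t n))) C) \<longlonglongrightarrow> 0"
    using LIMSEQ_subseq_LIMSEQ[OF _ l(2), of "\<lambda>n. infdist (Q (a n)) C"] by (simp add: comp_def)
  moreover have "(\<lambda>n. infdist (Q (a (t n))) C) \<longlonglongrightarrow> infdist l C"
    by (intro tendsto_infdist l(3))
  ultimately have "infdist l C = 0" by (metis LIMSEQ_unique)
  then have "l \<in> C" using in_closed_iff_infdist_zero[OF C_closed] c0 by auto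
  have "(\<lambda>n. \<Phi> l (a (t n))) \<longlonglongrightarrow> 0" by (rule \<Phi>_reciprocity[OF l(1,3)])
  then have "eventually (\<lambda>n. \<Phi> l (a (t n)) < e) sequentially" using \<open>e > 0\<close> by (rule order_tendstoD)
  then show False using a(2)[OF \<open>l \<in> C\<close>] by (simp add: not_less[symmetric])
qed

text \<open>
  Convergence of the noise is assumed against every basis vector because the limit point of the
  iterates is not known in advance.
\<close>

lemma trajectory_converges:
  fixes Y G \<zeta> x :: "nat \<Rightarrow> 'v" and \<gamma> :: "nat \<Rightarrow> real"
  assumes Y: "\<And>n. Y (Suc n) = Y n - \<gamma> n *\<^sub>R G n"
    and x: "\<And>n. x n = Q (Y n)" and \<zeta>: "\<And>n. \<zeta> n = g (x n) - G n"
    and \<gamma>: "\<And>n. 0 < \<gamma> n" "\<not> summable \<gamma>"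
    and p: "p \<in> C" "\<Phi> p (Y 0) < K * r\<^sup>2 / 4"
    and noise: "\<And>n. \<bar>\<Sum>k<n. \<gamma> k * (\<zeta> k \<bullet> (x k - p))\<bar> < K * r\<^sup>2 / 8"
    and squares: "\<And>n. (\<Sum>k<n. (\<gamma> k)\<^sup>2 * (norm (G k))\<^sup>2) < K\<^sup>2 * r\<^sup>2 / 4"
    and conv_x: "convergent (\<lambda>n. \<Sum>k<n. \<gamma> k * (\<zeta> k \<bullet> x k))"
    and conv_basis: "\<And>b. b \<in> Basis \<Longrightarrow> convergent (\<lambda>n. \<Sum>k<n. \<gamma> k * (\<zeta> k \<bullet> b))"
  shows "(\<lambda>n. infdist (x n) C) \<longlonglongrightarrow> 0"
proof -
  \<comment> \<open>The accumulated error against a reference point \<open>q\<close>: martingale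
    noise plus the second-order terms. All of the drift is kept outside it.\<close>
  define W where "W q n = (\<Sum>k<n. \<gamma> k * (\<zeta> k \<bullet> (x k - q)) + (\<gamma> k)\<^sup>2 * (norm (G k))\<^sup>2 / (2 * K))" for q n
  have xX: "x n \<in> X" for n by (simp add: x Q_in)
  have step: "\<Phi> q (Y (Suc n)) \<le> \<Phi> q (Y n) - \<gamma> n * (g (x n) \<bullet> (x n - q)) + (W q (Suc n) - W q n)"
    if "q \<in> X" for q n
  proof -
    have "W q (Suc n) - W q n = \<gamma> n * (\<zeta> n \<bullet> (x n - q)) + (\<gamma> n)\<^sup>2 * (norm (G n))\<^sup>2 / (2 * K)"
      by (simp add: W_def)
    moreover have "(- \<gamma> n *\<^sub>R G n) \<bullet> (x n - q) = \<gamma> n * (\<zeta> n \<bullet> (x n - q)) - \<gamma> n * (g (x n) \<bullet> (x n - q))"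
      by (simp add: \<zeta> inner_diff_left right_diff_distrib)
    moreover have "(norm (- \<gamma> n *\<^sub>R G n))\<^sup>2 = (\<gamma> n)\<^sup>2 * (norm (G n))\<^sup>2"
      by (simp add: power_mult_distrib)
    ultimately show ?thesis
      using \<Phi>_step[OF that, of "Y n" "- \<gamma> n *\<^sub>R G n"] by (simp add: Y x[symmetric])
  qed
  have descent: "\<Phi> q (Y n) \<le> \<Phi> q (Y m) - (\<Sum>k\<in>{m..<n}. \<gamma> k * (g (x k) \<bullet> (x k - q))) + (W q n - W q m)"
    if "q \<in> X" "m \<le> n" for q m n
    using \<open>m \<le> n\<close>
  proof (induction n rule: dec_induct)
    case (step n)
    with \<open>\<And>q n. q \<in> X \<Longrightarrow> \<Phi> q (Y (Suc n)) \<le> _\<close>[OF \<open>q \<in> X\<close>, of n] show ?case by simp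
  qed simp
  have W_split: "W q n = (\<Sum>k<n. \<gamma> k * (\<zeta> k \<bullet> (x k - q))) + (\<Sum>k<n. (\<gamma> k)\<^sup>2 * (norm (G k))\<^sup>2) / (2 * K)" for q n
    by (simp add: W_def sum.distrib sum_divide_distrib)
  have W_small: "W p n < K * r\<^sup>2 / 4" for n
  proof -
    \<comment> \<open>The threshold for the squares divided by \<open>2 * K\<close> equals
      \<open>K * r^2 / 8\<close>, the same share as the noise.\<close>
    have "(\<Sum>k<n. (\<gamma> k)\<^sup>2 * (norm (G k))\<^sup>2) / (2 * K) < K * r\<^sup>2 / 8"
      using squares[of n] K_pos by (simp add: field_simps power2_eq_square)
    then show ?thesis using noise[of n] unfolding W_split by linarith
  qed
  \<comment> \<open>Strong induction: if all earlier iterates are in the coherent region, the drift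
    up to \<open>n\<close> cannot increase the coupling. Start and errors together stay below
    \<open>K * r^2 / 2\<close>, which places \<open>x n\<close> within \<open>r\<close> of
    \<open>p\<close>.\<close>
  have near: "infdist (x n) C \<le> r" for n
  proof (induction n rule: less_induct)
    case (less n)
    have "(\<Sum>k\<in>{0..<n}. \<gamma> k * (g (x k) \<bullet> (x k - p))) \<ge> 0"
      using less coherent[OF xX _ p(1)] \<gamma>(1) by (intro sum_nonneg mult_nonneg_nonneg) (auto intro: less_imp_le)
    moreover have "p \<in> X" using p C_sub by auto
    moreover have "W p 0 = 0" by (simp add: W_def)
    ultimately have "\<Phi> p (Y n) < K * r\<^sup>2 / 2"
      using descent[of p 0 n] W_small[of n] p(2) by simp
    with \<Phi>_ge[OF \<open>p \<in> X\<close>, of "Y n"] have "K / 2 * (norm (x n - p))\<^sup>2 < K / 2 * r\<^sup>2" by (simp add: x)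
    then have "(norm (x n - p))\<^sup>2 < r\<^sup>2" using K_pos by simp
    then have "norm (x n - p) < r" using r_pos by (simp add: power2_less_imp_less)
    then show ?case using infdist_le[OF p(1), of "x n"] by (simp add: dist_norm)
  qed
  have drift: "0 \<le> \<gamma> n * (g (x n) \<bullet> (x n - c))" if "c \<in> C" for n c
    using coherent[OF xX near that] \<gamma>(1)[of n] by simp
  have squares_conv: "convergent (\<lambda>n. \<Sum>k<n. (\<gamma> k)\<^sup>2 * (norm (G k))\<^sup>2)"
    using summableI_nonneg_bounded[of "\<lambda>k. (\<gamma> k)\<^sup>2 * (norm (G k))\<^sup>2", OF _ less_imp_le[OF squares]]
    by (simp add: summable_iff_convergent)
  have W_conv: "convergent (W q)" for q
  proof -
    \<comment> \<open>Expanding \<open>q\<close> in the basis reduces convergence for arbitrary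
      \<open>q\<close> to finitely many series that do not depend on \<open>q\<close>.\<close>
    have "\<zeta> k \<bullet> q = (\<Sum>b\<in>Basis. (q \<bullet> b) * (\<zeta> k \<bullet> b))" for k
      by (subst euclidean_inner) (simp add: mult.commute)
    then have "(\<Sum>k<n. \<gamma> k * (\<zeta> k \<bullet> q)) = (\<Sum>k<n. \<Sum>b\<in>Basis. (q \<bullet> b) * (\<gamma> k * (\<zeta> k \<bullet> b)))" for n
      by (simp add: sum_distrib_left mult_ac)
    moreover have "(\<Sum>k<n. \<Sum>b\<in>Basis. (q \<bullet> b) * (\<gamma> k * (\<zeta> k \<bullet> b))) = (\<Sum>b\<in>Basis. (q \<bullet> b) * (\<Sum>k<n. \<gamma> k * (\<zeta> k \<bullet> b)))" for n
      by (subst sum.swap) (simp add: sum_distrib_left)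
    ultimately have "(\<Sum>k<n. \<gamma> k * (\<zeta> k \<bullet> (x k - q)))
        = (\<Sum>k<n. \<gamma> k * (\<zeta> k \<bullet> x k)) - (\<Sum>b\<in>Basis. (q \<bullet> b) * (\<Sum>k<n. \<gamma> k * (\<zeta> k \<bullet> b)))" for n
      by (simp add: inner_diff_right right_diff_distrib sum_subtractf)
    then have "W q = (\<lambda>n. (\<Sum>k<n. \<gamma> k * (\<zeta> k \<bullet> x k)) - (\<Sum>b\<in>Basis. (q \<bullet> b) * (\<Sum>k<n. \<gamma> k * (\<zeta> k \<bullet> b)))
       + (\<Sum>k<n. (\<gamma> k)\<^sup>2 * (norm (G k))\<^sup>2) * inverse (2 * K))"
      unfolding W_split[abs_def] divide_inverse by (simp only:)
    show ?thesis
      unfolding \<open>W q = _\<close>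
      by (intro convergent_add convergent_diff convergent_sum convergent_mult convergent_const
          conv_x conv_basis squares_conv)
  qed
  have "c0 \<in> X" using c0 C_sub by auto
  obtain B where B: "\<And>n. W c0 n \<le> B"
    using convergent_imp_Bseq[OF W_conv[of c0]] unfolding Bseq_def real_norm_def abs_le_iff
    by blast
  have "summable (\<lambda>k. \<gamma> k * (g (x k) \<bullet> (x k - c0)))"
  proof (rule summableI_nonneg_bounded)
    fix n show "(\<Sum>k<n. \<gamma> k * (g (x k) \<bullet> (x k - c0))) \<le> \<Phi> c0 (Y 0) + B"
      using descent[OF \<open>c0 \<in> X\<close>, of 0 n] \<Phi>_nonneg[OF \<open>c0 \<in> X\<close>, of "Y n"] B[of n]
      by (simp add: W_def atLeast0LessThan)
  qed (rule drift[OF c0])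
  then have sm: "summable (\<lambda>k. \<gamma> k * (g (x k) \<bullet> (x k - c0)) / e)" for e
    by (rule summable_divide)
  \<comment> \<open>A positive lower bound on the pairing from some index on would dominate the step
    sizes by a summable series, against their divergence.\<close>
  have "\<exists>n\<ge>m. g (x n) \<bullet> (x n - c0) < e" if "e > 0" for e m
  proof (rule ccontr)
    assume "\<not> ?thesis"
    then have *: "e \<le> g (x n) \<bullet> (x n - c0)" if "n \<ge> m" for n using that by (auto simp: not_less)
    have "norm (\<gamma> n) \<le> \<gamma> n * (g (x n) \<bullet> (x n - c0)) / e" if "n \<ge> m" for n
      using mult_left_mono[OF *[OF that], of "\<gamma> n"] \<gamma>(1)[of n] \<open>e > 0\<close> by (simp add: field_simps)
    from summable_comparison_test'[OF sm this] \<gamma>(2) show False by simp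
  qed
  then have "\<exists>n\<ge>j. g (x n) \<bullet> (x n - c0) < inverse (real (Suc j))" for j by simp
  then obtain s where s: "\<And>j. j \<le> s j" "\<And>j. g (x (s j)) \<bullet> (x (s j) - c0) < inverse (real (Suc j))"
    by metis
  obtain l t where l: "l \<in> X" "strict_mono t" "(\<lambda>n. x (s (t n))) \<longlonglongrightarrow> l"
    using X_compact[unfolded compact_def, rule_format, of "\<lambda>n. x (s n)"] xX by (auto simp: comp_def)
  have "(\<lambda>j. g (x (s j)) \<bullet> (x (s j) - c0)) \<longlonglongrightarrow> 0"
    by (rule LIMSEQ_if_dist_less_inverse)
      (use s(2) coherent[OF xX near c0] in \<open>simp add: dist_real_def\<close>)
  then have "(\<lambda>j. g (x (s (t j))) \<bullet> (x (s (t j)) - c0)) \<longlonglongrightarrow> 0"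
    using LIMSEQ_subseq_LIMSEQ[OF _ l(2), of "\<lambda>j. g (x (s j)) \<bullet> (x (s j) - c0)"] by (simp add: comp_def)
  moreover have "(\<lambda>j. g (x (s (t j))) \<bullet> (x (s (t j)) - c0)) \<longlonglongrightarrow> g l \<bullet> (l - c0)"
    by (intro tendsto_intros l(3) continuous_on_tendsto_compose[OF g_cont l(3) l(1)])
      (simp add: xX)
  ultimately have "g l \<bullet> (l - c0) = 0" by (metis LIMSEQ_unique)
  moreover have "infdist l C \<le> r"
    by (rule LIMSEQ_le_const2[OF tendsto_infdist[OF l(3)]]) (use near in auto)
  \<comment> \<open>Here the equality clause of coherence is used: vanishing of the pairing with the
    distinguished point puts the limit in \<open>C\<close>.\<close>
  ultimately have "l \<in> C" using coherent_c0 l(1) by blast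
  have \<Phi>l: "(\<lambda>j. \<Phi> l (Y (s (t j)))) \<longlonglongrightarrow> 0"
    by (rule \<Phi>_reciprocity[OF l(1)]) (use l(3) in \<open>simp add: x\<close>)
  have "(\<lambda>n. \<Phi> l (Y n)) \<longlonglongrightarrow> 0"
  proof (rule LIMSEQ_I)
    fix e :: real assume "e > 0"
    have "0 < e / 2" using \<open>e > 0\<close> by simp
    from metric_CauchyD[OF convergent_Cauchy[OF W_conv[of l]] this]
    obtain n0 where n0: "\<And>m n. m \<ge> n0 \<Longrightarrow> n \<ge> n0 \<Longrightarrow> \<bar>W l m - W l n\<bar> < e / 2"
      unfolding dist_real_def by blast
    have "eventually (\<lambda>j. \<Phi> l (Y (s (t j))) < e / 2 \<and> n0 \<le> j) sequentially"
      by (intro eventually_conj order_tendstoD(2)[OF \<Phi>l \<open>0 < e / 2\<close>] eventually_ge_at_top)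
    then obtain j where j: "\<Phi> l (Y (s (t j))) < e / 2" "n0 \<le> j"
      by (auto simp: eventually_sequentially)
    \<comment> \<open>Both \<open>s\<close> and \<open>t\<close> dominate the identity, so the
      chosen time lies beyond the Cauchy index of the error.\<close>
    have "n0 \<le> s (t j)" using j(2) s(1)[of "t j"] seq_suble[OF l(2), of j] by linarith
    have "norm (\<Phi> l (Y n) - 0) < e" if n: "n \<ge> s (t j)" for n
    proof -
      have "(\<Sum>k\<in>{s (t j)..<n}. \<gamma> k * (g (x k) \<bullet> (x k - l))) \<ge> 0"
        using drift[OF \<open>l \<in> C\<close>] by (intro sum_nonneg)
      moreover have "W l n - W l (s (t j)) < e / 2"
        using n0[of n "s (t j)"] n \<open>n0 \<le> s (t j)\<close> by linarith
      ultimately have "\<Phi> l (Y n) < e" using descent[OF l(1) n] j(1) by linarith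
      then show ?thesis using \<Phi>_nonneg[OF l(1), of "Y n"] by simp
    qed
    then show "\<exists>n0. \<forall>n\<ge>n0. norm (\<Phi> l (Y n) - 0) < e" by auto
  qed
  then have "(\<lambda>n. 2 / K * \<Phi> l (Y n)) \<longlonglongrightarrow> 2 / K * 0" by (rule tendsto_mult_left)
  then have bound: "(\<lambda>n. 2 / K * \<Phi> l (Y n)) \<longlonglongrightarrow> 0" by simp
  have "(infdist (x n) C)\<^sup>2 \<le> 2 / K * \<Phi> l (Y n)" for n
  proof -
    have "(infdist (x n) C)\<^sup>2 \<le> (norm (x n - l))\<^sup>2"
      using infdist_le[OF \<open>l \<in> C\<close>, of "x n"] by (intro power_mono) (auto simp: dist_norm infdist_nonneg)
    also have "\<dots> \<le> 2 / K * \<Phi> l (Y n)" using \<Phi>_ge[OF l(1), of "Y n"] K_pos by (simp add: x field_simps)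
    finally show ?thesis .
  qed
  then have "(\<lambda>n. (infdist (x n) C)\<^sup>2) \<longlonglongrightarrow> 0"
    by (intro tendsto_sandwich[OF _ _ tendsto_const bound]) auto
  then show ?thesis by simp
qed

end

section \<open>Stochastic mirror descent\<close>

text \<open>The recursion of \<open>smd_dual\<close> in Riesz coordinates, driven by the regularized
  oracle. The two agree along every sample path that avoids the exceptional null set.\<close>

primrec dual_path :: "('v \<Rightarrow> 'v) \<Rightarrow> ('v \<Rightarrow> 'w \<Rightarrow> 'v) \<Rightarrow> (nat \<Rightarrow> real) \<Rightarrow> 'v \<Rightarrow> (nat \<Rightarrow> 'w) \<Rightarrow> nat
    \<Rightarrow> 'v::real_vector" where
  "dual_path Q \<Gamma> \<gamma> a w 0 = a"
| "dual_path Q \<Gamma> \<gamma> a w (Suc n) =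
     dual_path Q \<Gamma> \<gamma> a w n - \<gamma> n *\<^sub>R \<Gamma> (Q (dual_path Q \<Gamma> \<gamma> a w n)) (w n)"

locale stochastic_mirror_descent =
  iid_sequence M P w + continuous_oracle P \<Gamma> V
  for M :: "'m measure" and P :: "'w measure" and w :: "nat \<Rightarrow> 'm \<Rightarrow> 'w"
    and \<Gamma> :: "'v::euclidean_space \<Rightarrow> 'w \<Rightarrow> 'v" and V :: real +
  fixes Q :: "'v \<Rightarrow> 'v" and \<gamma> :: "nat \<Rightarrow> real" and a1 :: 'v
  assumes Q_meas [measurable]: "Q \<in> borel_measurable borel"
    and \<gamma>_square_summable: "summable (\<lambda>n. (\<gamma> n)\<^sup>2)"
begin

abbreviation H :: "nat \<Rightarrow> 'm measure" where "H \<equiv> history M P w"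

section \<open>Adaptedness and second moments of the random iterates\<close>

definition Y :: "nat \<Rightarrow> 'm \<Rightarrow> 'v" where "Y n m = dual_path Q \<Gamma> \<gamma> a1 (\<lambda>k. w k m) n"
definition x :: "nat \<Rightarrow> 'm \<Rightarrow> 'v" where "x n m = Q (Y n m)"
definition G :: "nat \<Rightarrow> 'm \<Rightarrow> 'v" where "G n m = \<Gamma> (x n m) (w n m)"
definition \<zeta> :: "nat \<Rightarrow> 'm \<Rightarrow> 'v" where "\<zeta> n m = g (x n m) - G n m"

lemma Y_0: "Y 0 m = a1" by (simp add: Y_def)
lemma Y_Suc: "Y (Suc n) m = Y n m - \<gamma> n *\<^sub>R G n m" by (simp add: Y_def x_def G_def)

text \<open>\<open>Y n\<close> uses only the samples with indices below \<open>n\<close>, so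
  \<open>w n\<close> is fresh when the gradient at \<open>x n\<close> is drawn.\<close>

lemma Y_adapted: "Y n \<in> borel_measurable (H n)"
proof (induction n)
  case 0 show ?case by (simp add: Y_0)
next
  case (Suc n)
  have [measurable]: "Y n \<in> borel_measurable (H (Suc n))"
    by (rule measurable_from_subalg[OF history_mono Suc])
  have [measurable]: "w n \<in> measurable (H (Suc n)) P" by (rule w_measurable_history) simp
  show ?case unfolding Y_Suc[abs_def] G_def x_def by measurable
qed

lemma x_adapted: "x n \<in> borel_measurable (H n)"
  unfolding x_def[abs_def] by (rule measurable_compose[OF Y_adapted Q_meas])

lemma Y_measurable [measurable]: "Y n \<in> borel_measurable M"
  by (rule measurable_from_subalg[OF subalgebra_history Y_adapted])

lemma x_measurable [measurable]: "x n \<in> borel_measurable M"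
  by (rule measurable_from_subalg[OF subalgebra_history x_adapted])

lemma G_measurable [measurable]: "G n \<in> borel_measurable M"
  unfolding G_def[abs_def] by measurable

lemma x_adapted_Suc: "x n \<in> borel_measurable (H (Suc n))"
  by (rule measurable_from_subalg[OF history_mono x_adapted])

lemma G_adapted: "G n \<in> borel_measurable (H (Suc n))"
  unfolding G_def[abs_def] using x_adapted_Suc[of n] w_measurable_history[of n "Suc n"] by measurable

lemma \<Gamma>_x_measurable [measurable]: "(\<lambda>p. \<Gamma> (x n (fst p)) (snd p)) \<in> borel_measurable (H n \<Otimes>\<^sub>M P)"
  by (rule \<Gamma>_compose[OF measurable_compose[OF measurable_fst x_adapted] measurable_snd])

text \<open>The moment bound is given for fixed points; freezing the past transfers it to the random
  point \<open>x n\<close>.\<close>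

lemma nn_integral_G_square: "(\<integral>\<^sup>+m. ennreal ((norm (G n m))\<^sup>2) \<partial>M) \<le> ennreal (V\<^sup>2)"
proof -
  let ?\<phi> = "\<lambda>p. ennreal ((norm (\<Gamma> (x n (fst p)) (snd p)))\<^sup>2)"
  have "(\<integral>\<^sup>+m. ?\<phi> (m, w n m) \<partial>M) = (\<integral>\<^sup>+m. (\<integral>\<^sup>+b. ?\<phi> (m, b) \<partial>P) \<partial>M)"
    by (rule nn_integral_freezing[OF subalgebra_history w_measurable indep_history w_law])
      (auto intro!: measurable_compose[OF \<Gamma>_x_measurable])
  then have "(\<integral>\<^sup>+m. ennreal ((norm (G n m))\<^sup>2) \<partial>M)
      = (\<integral>\<^sup>+m. (\<integral>\<^sup>+b. ennreal ((norm (\<Gamma> (x n m) b))\<^sup>2) \<partial>P) \<partial>M)"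
    by (simp only: fst_conv snd_conv G_def)
  also have "\<dots> \<le> (\<integral>\<^sup>+m. ennreal (V\<^sup>2) \<partial>M)" by (intro nn_integral_mono \<Gamma>_square)
  also have "\<dots> = ennreal (V\<^sup>2)" by (simp add: emeasure_space_1)
  finally show ?thesis .
qed

lemma G_square_integrable: "integrable M (\<lambda>m. (norm (G n m))\<^sup>2)"
  using nn_integral_G_square[of n] by (intro integrableI_bounded) (auto intro: le_less_trans)

lemma expectation_G_square: "expectation (\<lambda>m. (norm (G n m))\<^sup>2) \<le> V\<^sup>2"
proof -
  have "ennreal (expectation (\<lambda>m. (norm (G n m))\<^sup>2)) \<le> ennreal (V\<^sup>2)"
    using nn_integral_G_square[of n] nn_integral_eq_integral[OF G_square_integrable, of n] by simp
  then show ?thesis by (simp add: ennreal_le_iff)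
qed

lemma noise_square_bound:
  assumes "\<And>z. norm (u (Q z)) \<le> B"
  shows "(\<gamma> n * (\<zeta> n m \<bullet> u (x n m)))\<^sup>2 \<le> (\<gamma> n)\<^sup>2 * (B\<^sup>2 * (2 * V\<^sup>2 + 2 * (norm (G n m))\<^sup>2))"
proof -
  have "\<bar>\<zeta> n m \<bullet> u (x n m)\<bar> \<le> norm (\<zeta> n m) * norm (u (x n m))" by (rule Cauchy_Schwarz_ineq2)
  also have "\<dots> \<le> norm (\<zeta> n m) * B" unfolding x_def by (intro mult_left_mono assms) simp
  finally have "(\<zeta> n m \<bullet> u (x n m))\<^sup>2 \<le> (norm (\<zeta> n m) * B)\<^sup>2"
    by (metis abs_ge_zero power2_abs power_mono)
  also have "(norm (\<zeta> n m))\<^sup>2 \<le> 2 * V\<^sup>2 + 2 * (norm (G n m))\<^sup>2"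
  proof -
    have "norm (\<zeta> n m) \<le> V + norm (G n m)"
      unfolding \<zeta>_def using norm_triangle_ineq4[of "g (x n m)" "G n m"] norm_g_le[of "x n m"] by linarith
    then have "(norm (\<zeta> n m))\<^sup>2 \<le> (V + norm (G n m))\<^sup>2" by (intro power_mono) auto
    also have "\<dots> \<le> 2 * V\<^sup>2 + 2 * (norm (G n m))\<^sup>2"
      using sum_squares_bound[of V "norm (G n m)"] by (simp add: power2_sum)
    finally show ?thesis .
  qed
  then have "(norm (\<zeta> n m) * B)\<^sup>2 \<le> B\<^sup>2 * (2 * V\<^sup>2 + 2 * (norm (G n m))\<^sup>2)"
    by (simp add: power_mult_distrib mult.commute[of _ "B\<^sup>2"] mult_left_mono)
  finally show ?thesis unfolding power_mult_distrib by (intro mult_left_mono) auto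
qed

text \<open>The test field \<open>u\<close> covers the three pairings needed: \<open>x - p\<close>
  for confinement, \<open>x\<close> itself and a constant basis vector for convergence. In each case
  it depends only on the current iterate, so freezing the past centres the increment. The factor 4
  comes from \<open>2 * V^2\<close> for the mean gradient and again for the sample.\<close>

lemma noise_martingale:
  assumes u [measurable]: "u \<in> borel_measurable borel" and B: "\<And>z. norm (u (Q z)) \<le> B"
  shows "martingale_differences M H (\<lambda>n m. \<gamma> n * (\<zeta> n m \<bullet> u (x n m)))" (is "martingale_differences M H ?d")
    and "expectation (\<lambda>m. (\<gamma> n * (\<zeta> n m \<bullet> u (x n m)))\<^sup>2) \<le> 4 * B\<^sup>2 * V\<^sup>2 * (\<gamma> n)\<^sup>2"
proof -
  have [measurable]: "\<zeta> n \<in> borel_measurable M" for n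
    unfolding \<zeta>_def[abs_def] by measurable
  have maj: "integrable M (\<lambda>m. (\<gamma> n)\<^sup>2 * (B\<^sup>2 * (2 * V\<^sup>2 + 2 * (norm (G n m))\<^sup>2)))" for n
    using G_square_integrable[of n] by simp
  have sq: "integrable M (\<lambda>m. (?d n m)\<^sup>2)" for n
    by (rule Bochner_Integration.integrable_bound[OF maj[of n]])
      (use noise_square_bound[of u B n, OF B] in \<open>auto intro!: AE_I2 intro: order_trans[OF _ abs_ge_self]\<close>)
  show "martingale_differences M H ?d"
  proof
    fix n
    show "subalgebra M (H n)" by (rule subalgebra_history)
    show "subalgebra (H (Suc n)) (H n)" by (rule history_mono)
    have [measurable]: "x n \<in> borel_measurable (H (Suc n))" "G n \<in> borel_measurable (H (Suc n))"
      by (rule x_adapted_Suc G_adapted)+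
    show "?d n \<in> borel_measurable (H (Suc n))" unfolding \<zeta>_def by measurable
    show "integrable M (\<lambda>m. (?d n m)\<^sup>2)" by (rule sq)
    fix A assume A [measurable]: "A \<in> sets (H n)"
    have "A \<in> sets M" using A subalgebra_history[of n] by (auto simp: subalgebra_def)
    have [measurable]: "x n \<in> borel_measurable (H n)" by (rule x_adapted)
    define \<phi> where "\<phi> p = indicator A (fst p) *
        (\<gamma> n * ((g (x n (fst p)) - \<Gamma> (x n (fst p)) (snd p)) \<bullet> u (x n (fst p))))" for p
    have \<phi>: "\<phi> \<in> borel_measurable (H n \<Otimes>\<^sub>M P)" unfolding \<phi>_def[abs_def] by measurable
    have d_int: "integrable M (?d n)"
      using integrable_mult_of_squares[of "?d n" M "\<lambda>_. 1"] sq[of n] by simp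
    have "(\<integral>m\<in>A. ?d n m \<partial>M) = (\<integral>m. \<phi> (m, w n m) \<partial>M)"
      unfolding set_lebesgue_integral_def \<phi>_def \<zeta>_def G_def fst_conv snd_conv real_scaleR_def ..
    also have "\<dots> = (\<integral>m. (\<integral>b. \<phi> (m, b) \<partial>P) \<partial>M)"
    proof (rule integral_freezing[OF subalgebra_history w_measurable indep_history w_law \<phi>])
      show "integrable M (\<lambda>m. \<phi> (m, w n m))"
        using integrable_mult_indicator[OF \<open>A \<in> sets M\<close> d_int]
        unfolding \<phi>_def \<zeta>_def G_def fst_conv snd_conv real_scaleR_def .
    qed
    also have "\<dots> = (\<integral>m. 0 \<partial>M)"
    proof (rule Bochner_Integration.integral_cong[OF refl])
      fix m
      have "(\<integral>b. (g (x n m) - \<Gamma> (x n m) b) \<bullet> u (x n m) \<partial>P) = 0"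
        using \<Gamma>_integrable[of "x n m"] by (simp add: inner_diff_left g_inner P.prob_space)
      then show "(\<integral>b. \<phi> (m, b) \<partial>P) = 0" by (simp add: \<phi>_def)
    qed
    finally show "(\<integral>m\<in>A. ?d n m \<partial>M) = 0" by simp
  qed
  have "expectation (\<lambda>m. (?d n m)\<^sup>2) \<le> expectation (\<lambda>m. (\<gamma> n)\<^sup>2 * (B\<^sup>2 * (2 * V\<^sup>2 + 2 * (norm (G n m))\<^sup>2)))"
    by (rule integral_mono[OF sq maj noise_square_bound[of u B, OF B]])
  also have "\<dots> = (\<gamma> n)\<^sup>2 * (B\<^sup>2 * (2 * V\<^sup>2 + 2 * expectation (\<lambda>m. (norm (G n m))\<^sup>2)))"
    using G_square_integrable[of n] by (simp add: prob_space)
  also have "\<dots> \<le> (\<gamma> n)\<^sup>2 * (B\<^sup>2 * (2 * V\<^sup>2 + 2 * V\<^sup>2))"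
    using expectation_G_square[of n] by (intro mult_left_mono add_left_mono) auto
  finally show "expectation (\<lambda>m. (?d n m)\<^sup>2) \<le> 4 * B\<^sup>2 * V\<^sup>2 * (\<gamma> n)\<^sup>2" by (simp add: mult_ac)
qed

section \<open>Probability bounds for the accumulated errors\<close>

lemma noise_summable:
  assumes "u \<in> borel_measurable borel" "\<And>z. norm (u (Q z)) \<le> B"
  shows "summable (\<lambda>n. expectation (\<lambda>m. (\<gamma> n * (\<zeta> n m \<bullet> u (x n m)))\<^sup>2))"
  by (rule summable_comparison_test'[OF summable_mult[OF \<gamma>_square_summable, of "4 * B\<^sup>2 * V\<^sup>2"]])
    (use noise_martingale(2)[OF assms] in auto)

lemma AE_noise_convergent:
  assumes "u \<in> borel_measurable borel" "\<And>z. norm (u (Q z)) \<le> B"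
  shows "AE m in M. convergent (\<lambda>n. \<Sum>k<n. \<gamma> k * (\<zeta> k m \<bullet> u (x k m)))"
  by (rule martingale_differences.AE_convergent[OF noise_martingale(1)[OF assms] noise_summable[OF assms]])

lemma prob_noise_large:
  assumes "u \<in> borel_measurable borel" "\<And>z. norm (u (Q z)) \<le> B" "a > 0"
  shows "prob {m \<in> space M. \<exists>n. a \<le> \<bar>\<Sum>k<n. \<gamma> k * (\<zeta> k m \<bullet> u (x k m))\<bar>}
      \<le> 4 * B\<^sup>2 * V\<^sup>2 * (\<Sum>n. (\<gamma> n)\<^sup>2) / a\<^sup>2"
proof -
  have "prob {m \<in> space M. \<exists>n. a \<le> \<bar>\<Sum>k<n. \<gamma> k * (\<zeta> k m \<bullet> u (x k m))\<bar>}
      \<le> (\<Sum>n. expectation (\<lambda>m. (\<gamma> n * (\<zeta> n m \<bullet> u (x n m)))\<^sup>2)) / a\<^sup>2"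
    by (rule martingale_differences.Kolmogorov_maximal_infinite[OF noise_martingale(1)[OF assms(1,2)]
          assms(3) noise_summable[OF assms(1,2)]])
  also have "\<dots> \<le> (\<Sum>n. 4 * B\<^sup>2 * V\<^sup>2 * (\<gamma> n)\<^sup>2) / a\<^sup>2"
    by (intro divide_right_mono suminf_le noise_martingale(2)[OF assms(1,2)] noise_summable[OF assms(1,2)]
        summable_mult \<gamma>_square_summable) simp
  also have "\<dots> = 4 * B\<^sup>2 * V\<^sup>2 * (\<Sum>n. (\<gamma> n)\<^sup>2) / a\<^sup>2"
    by (simp add: suminf_mult[OF \<gamma>_square_summable])
  finally show ?thesis .
qed

text \<open>The terms are nonnegative, so the partial sums are dominated by the full series and
  Markov's inequality suffices. Extended values make that series meaningful before its convergence
  is known.\<close>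

lemma prob_squares_large:
  assumes a: "a > 0"
  shows "prob {m \<in> space M. \<exists>n. a \<le> (\<Sum>k<n. (\<gamma> k)\<^sup>2 * (norm (G k m))\<^sup>2)} \<le> V\<^sup>2 * (\<Sum>n. (\<gamma> n)\<^sup>2) / a"
proof -
  let ?q = "\<lambda>k m. (\<gamma> k)\<^sup>2 * (norm (G k m))\<^sup>2"
  have sum_nonneg: "0 \<le> (\<Sum>k. (\<gamma> k)\<^sup>2)" by (intro suminf_nonneg \<gamma>_square_summable) simp
  let ?T = "\<lambda>m. \<Sum>k. ennreal (?q k m)"
  have "{m \<in> space M. \<exists>n. a \<le> (\<Sum>k<n. ?q k m)} \<subseteq> {m \<in> space M. 1 \<le> ennreal (1 / a) * ?T m}"
  proof (intro Collect_mono conjI impI; elim conjE exE)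
    fix m n assume "a \<le> (\<Sum>k<n. ?q k m)"
    then have "ennreal a \<le> (\<Sum>k<n. ennreal (?q k m))" by (simp add: sum_ennreal ennreal_leI)
    also have "\<dots> \<le> ?T m" by (rule sum_le_suminf) auto
    finally have "ennreal (1 / a) * ennreal a \<le> ennreal (1 / a) * ?T m" by (rule mult_left_mono) simp
    then show "1 \<le> ennreal (1 / a) * ?T m" using a by (simp flip: ennreal_mult')
  qed
  then have "emeasure M {m \<in> space M. \<exists>n. a \<le> (\<Sum>k<n. ?q k m)}
      \<le> emeasure M {m \<in> space M. 1 \<le> ennreal (1 / a) * ?T m}"
    by (rule emeasure_mono) measurable
  also have "\<dots> \<le> ennreal (1 / a) * (\<integral>\<^sup>+m. ?T m * indicator (space M) m \<partial>M)"
    by (rule nn_integral_Markov_inequality) auto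
  also have "(\<integral>\<^sup>+m. ?T m * indicator (space M) m \<partial>M) = (\<Sum>k. \<integral>\<^sup>+m. ennreal (?q k m) \<partial>M)"
    by (subst nn_integral_suminf[symmetric]) (auto intro!: nn_integral_cong)
  also have "\<dots> \<le> (\<Sum>k. ennreal (V\<^sup>2 * (\<gamma> k)\<^sup>2))"
  proof (rule suminf_le)
    fix k
    have "(\<integral>\<^sup>+m. ennreal (?q k m) \<partial>M) = ennreal ((\<gamma> k)\<^sup>2) * (\<integral>\<^sup>+m. ennreal ((norm (G k m))\<^sup>2) \<partial>M)"
      by (simp add: ennreal_mult' nn_integral_cmult)
    also have "\<dots> \<le> ennreal ((\<gamma> k)\<^sup>2) * ennreal (V\<^sup>2)"
      by (intro mult_left_mono nn_integral_G_square) simp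
    also have "\<dots> = ennreal (V\<^sup>2 * (\<gamma> k)\<^sup>2)" by (simp add: ennreal_mult' mult.commute)
    finally show "(\<integral>\<^sup>+m. ennreal (?q k m) \<partial>M) \<le> ennreal (V\<^sup>2 * (\<gamma> k)\<^sup>2)" .
  qed auto
  also have "(\<Sum>k. ennreal (V\<^sup>2 * (\<gamma> k)\<^sup>2)) = ennreal (V\<^sup>2 * (\<Sum>k. (\<gamma> k)\<^sup>2))"
    using \<gamma>_square_summable by (subst suminf_ennreal2) (auto simp: suminf_mult intro: summable_mult)
  finally have "emeasure M {m \<in> space M. \<exists>n. a \<le> (\<Sum>k<n. ?q k m)}
      \<le> ennreal (1 / a) * ennreal (V\<^sup>2 * (\<Sum>k. (\<gamma> k)\<^sup>2))"
    by (simp add: mult_left_mono)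
  also have "\<dots> = ennreal (V\<^sup>2 * (\<Sum>k. (\<gamma> k)\<^sup>2) / a)"
    using a sum_nonneg by (subst ennreal_mult[symmetric]) auto
  finally show ?thesis
    unfolding emeasure_eq_measure using a
      sum_nonneg by (subst (asm) ennreal_le_iff) auto
qed


lemma convergence_event_measurable [measurable]:
  "{m \<in> space M. (\<lambda>n. infdist (x n m) C) \<longlonglongrightarrow> 0} \<in> sets M"
proof -
  have "(\<lambda>m. infdist (x n m) C) \<in> borel_measurable M" for n
    by (rule measurable_compose[OF x_measurable borel_measurable_continuous_onI])
      (intro continuous_intros)
  then show ?thesis by measurable
qed

text \<open>Off null sets, divergence requires one of the events \<open>E1\<close> and
  \<open>E2\<close>, and the union bound gives the coefficient of the squared step sizes. Its first
  term is \<open>4 * (2 * R)^2 * V^2\<close> over the square of the noise level.\<close>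

lemma prob_trajectory_converges:
  assumes geometry: "coherent_mirror_geometry X C Q \<Phi> K g r c0"
    and \<gamma>: "\<And>n. 0 < \<gamma> n" "\<not> summable \<gamma>"
    and R: "\<And>x. x \<in> X \<Longrightarrow> norm x \<le> R"
    and p: "p \<in> C" "\<Phi> p a1 < K * r\<^sup>2 / 4"
  shows "1 - (16 * R\<^sup>2 * V\<^sup>2 / (K * r\<^sup>2 / 8)\<^sup>2 + V\<^sup>2 / (K\<^sup>2 * r\<^sup>2 / 4)) * (\<Sum>n. (\<gamma> n)\<^sup>2)
    \<le> prob {m \<in> space M. (\<lambda>n. infdist (x n m) C) \<longlonglongrightarrow> 0}"
proof -
  interpret geo: coherent_mirror_geometry X C Q \<Phi> K g r c0 by (rule geometry)
  let ?A = "{m \<in> space M. (\<lambda>n. infdist (x n m) C) \<longlonglongrightarrow> 0}"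
  have KR: "0 < K * r\<^sup>2 / 8" "0 < K\<^sup>2 * r\<^sup>2 / 4" using geo.K_pos geo.r_pos by auto
  have pX: "p \<in> X" using p geo.C_sub by auto
  \<comment> \<open>The bound \<open>2 * R\<close> is the same for every base point, so the final
    estimate does not depend on \<open>p\<close>.\<close>
  have bound_p: "norm (Q z - p) \<le> 2 * R" for z
    using R[OF geo.Q_in, of z] R[OF pX] norm_triangle_ineq4[of "Q z" p] by linarith
  define E1 where "E1 = {m \<in> space M. \<exists>n. K * r\<^sup>2 / 8 \<le> \<bar>\<Sum>k<n. \<gamma> k * (\<zeta> k m \<bullet> (x k m - p))\<bar>}"
  define E2 where "E2 = {m \<in> space M. \<exists>n. K\<^sup>2 * r\<^sup>2 / 4 \<le> (\<Sum>k<n. (\<gamma> k)\<^sup>2 * (norm (G k m))\<^sup>2)}"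
  have [measurable]: "\<zeta> n \<in> borel_measurable M" for n
    unfolding \<zeta>_def[abs_def] by measurable
  have [measurable]: "E1 \<in> sets M" "E2 \<in> sets M" unfolding E1_def E2_def by measurable
  have P1: "prob E1 \<le> 4 * (2 * R)\<^sup>2 * V\<^sup>2 * (\<Sum>n. (\<gamma> n)\<^sup>2) / (K * r\<^sup>2 / 8)\<^sup>2"
    unfolding E1_def by (rule prob_noise_large[where u = "\<lambda>x. x - p", OF _ bound_p KR(1)]) measurable
  have P2: "prob E2 \<le> V\<^sup>2 * (\<Sum>n. (\<gamma> n)\<^sup>2) / (K\<^sup>2 * r\<^sup>2 / 4)"
    unfolding E2_def by (rule prob_squares_large[OF KR(2)])
  have "AE m in M. convergent (\<lambda>n. \<Sum>k<n. \<gamma> k * (\<zeta> k m \<bullet> x k m))"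
    by (rule AE_noise_convergent[where u = "\<lambda>x. x" and B = R]) (auto intro: R geo.Q_in)
  moreover have "AE m in M. \<forall>b\<in>Basis. convergent (\<lambda>n. \<Sum>k<n. \<gamma> k * (\<zeta> k m \<bullet> b))"
    by (intro AE_finite_allI AE_noise_convergent[where u = "\<lambda>x. _" and B = 1]) auto
  ultimately have "AE m in M. m \<in> space M - ?A \<longrightarrow> m \<in> E1 \<union> E2"
  proof (rule AE_mp[OF _ AE_mp], intro AE_I2 impI)
    fix m assume m: "m \<in> space M" and conv: "convergent (\<lambda>n. \<Sum>k<n. \<gamma> k * (\<zeta> k m \<bullet> x k m))"
      "\<forall>b\<in>Basis. convergent (\<lambda>n. \<Sum>k<n. \<gamma> k * (\<zeta> k m \<bullet> b))" and "m \<in> space M - ?A"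
    then have diverges: "\<not> (\<lambda>n. infdist (x n m) C) \<longlonglongrightarrow> 0" by simp
    show "m \<in> E1 \<union> E2"
    proof (rule ccontr)
      assume "m \<notin> E1 \<union> E2"
      then have "\<bar>\<Sum>k<n. \<gamma> k * (\<zeta> k m \<bullet> (x k m - p))\<bar> < K * r\<^sup>2 / 8"
        "(\<Sum>k<n. (\<gamma> k)\<^sup>2 * (norm (G k m))\<^sup>2) < K\<^sup>2 * r\<^sup>2 / 4" for n
        using m by (auto simp: E1_def E2_def not_le)
      then have "(\<lambda>n. infdist (x n m) C) \<longlonglongrightarrow> 0"
        using conv \<gamma> p
        by (intro geo.trajectory_converges[where Y = "\<lambda>n. Y n m" and G = "\<lambda>n. G n m"
              and \<zeta> = "\<lambda>n. \<zeta> n m" and \<gamma> = \<gamma> and p = p]) (auto simp: Y_Suc Y_0 x_def \<zeta>_def)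
      then show False using diverges by simp
    qed
  qed
  then have "prob (space M - ?A) \<le> prob (E1 \<union> E2)"
    by (intro finite_measure_mono_AE) auto
  also have "\<dots> \<le> prob E1 + prob E2" by (rule measure_Un_le) auto
  finally have "1 - prob ?A \<le> prob E1 + prob E2" by (simp add: prob_compl)
  moreover have eq: "4 * (2 * R)\<^sup>2 * V\<^sup>2 * (\<Sum>n. (\<gamma> n)\<^sup>2) = 16 * R\<^sup>2 * V\<^sup>2 * (\<Sum>n. (\<gamma> n)\<^sup>2)"
    by (simp add: power_mult_distrib)
  ultimately show ?thesis
    using P1[unfolded eq] P2 unfolding distrib_right times_divide_eq_left by linarith
qed

end

theorem theorem5p2:
  fixes N :: "'v::euclidean_space \<Rightarrow> real"
    and X C :: "'v set"
    and P :: "'w measure"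
    and F :: "'v \<Rightarrow> 'w \<Rightarrow> real"
    and G :: "'v \<Rightarrow> 'w \<Rightarrow> 'v \<Rightarrow>\<^sub>L real"
    and f :: "'v \<Rightarrow> real"
    and h :: "'v \<Rightarrow> real"
  assumes norm_N: "vector_norm N"
    and X: "X \<noteq> {}" "compact X" "convex X"
    and P: "prob_space P" "complete_measure P"
    and F_integrable: "\<And>x. x \<in> X \<Longrightarrow> integrable P (F x)"
    and f_def: "\<And>x. x \<in> X \<Longrightarrow> f x = (\<integral>\<omega>. F x \<omega> \<partial>P)"
    and G_measurable: "\<And>x. x \<in> X \<Longrightarrow> G x \<in> borel_measurable P"
    and h: "regularizer N X h"
    and coherent: "locally_coherent N X f C"
    and i: "AE \<omega> in P. C1_with_gradient_on X (\<lambda>x. F x \<omega>) (\<lambda>x. G x \<omega>)"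
    and ii: "\<exists>V\<ge>0. \<forall>x\<in>X. (\<integral>\<^sup>+\<omega>. ennreal ((dual_norm N (G x \<omega>))\<^sup>2) \<partial>P) \<le> ennreal (V\<^sup>2)"
    and iii: "\<And>p y. p \<in> X \<Longrightarrow> (\<lambda>n. mirror_map X h (y n)) \<longlonglongrightarrow> p \<Longrightarrow>
                (\<lambda>n. Fenchel_coupling X h p (y n)) \<longlonglongrightarrow> 0"
  shows "\<exists>U. openin (top_of_set X) U \<and> C \<subseteq> U \<and>
           (\<forall>\<delta>>0. \<exists>\<eta>>0.
              \<forall>(M :: 'm measure) w (\<gamma> :: nat \<Rightarrow> real) y1.
                prob_space M \<longrightarrow> iid_samples M P w \<longrightarrow>
                (\<forall>n. \<gamma> n > 0) \<longrightarrow> summable (\<lambda>n. (\<gamma> n)\<^sup>2) \<longrightarrow> \<not> summable \<gamma> \<longrightarrow>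
                (\<Sum>n. (\<gamma> n)\<^sup>2) \<le> \<eta> \<longrightarrow>
                mirror_map X h y1 \<in> U \<longrightarrow>
                measure (completion M)
                  {m \<in> space M.
                     (\<lambda>n. norm_dist_to N C (smd_iterate X h G \<gamma> y1 (\<lambda>k. w k m) n)) \<longlonglongrightarrow> 0}
                \<ge> 1 - \<delta>)"
proof -
  interpret P: prob_space P by (rule P)
  obtain a b where a: "0 < a" "\<And>x. a * norm x \<le> N x" and b: "0 < b" "\<And>x. N x \<le> b * norm x"
    using vector_norm_equivalent[OF norm_N] by blast
  obtain K0 where K0: "K0 > 0" "strongly_convex_on N K0 X h" and h_cont: "continuous_on X h"
    using h unfolding regularizer_def by auto
  \<comment> \<open>Passing from \<open>N\<close> to the Euclidean norm costs the factor
    \<open>a^2\<close>, because \<open>a * norm x \<le> N x\<close> enters squared.\<close>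
  define K where "K = K0 * a\<^sup>2"
  interpret mirror_setup X h K
  proof
    show "strongly_convex_on norm K X h"
      unfolding strongly_convex_on_def
    proof (intro ballI)
      fix x x' t assume xt: "x \<in> X" "x' \<in> X" "t \<in> {0..1::real}"
      have "(a * norm (x' - x))\<^sup>2 \<le> (N (x' - x))\<^sup>2"
        using a(1) by (intro power_mono a) auto
      then have "K0 / 2 * t * (1 - t) * (a * norm (x' - x))\<^sup>2 \<le> K0 / 2 * t * (1 - t) * (N (x' - x))\<^sup>2"
        using xt K0 by (intro mult_left_mono) auto
      moreover have "h (t *\<^sub>R x + (1 - t) *\<^sub>R x') \<le> t * h x + (1 - t) * h x' - K0 / 2 * t * (1 - t) * (N (x' - x))\<^sup>2"
        using K0(2) xt by (auto simp: strongly_convex_on_def)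
      moreover have "K / 2 * t * (1 - t) * (norm (x' - x))\<^sup>2 = K0 / 2 * t * (1 - t) * (a * norm (x' - x))\<^sup>2"
        by (simp add: K_def power_mult_distrib)
      ultimately show "h (t *\<^sub>R x + (1 - t) *\<^sub>R x') \<le> t * h x + (1 - t) * h x' - K / 2 * t * (1 - t) * (norm (x' - x))\<^sup>2"
        by linarith
    qed
  qed (use X h_cont K0 a in \<open>auto simp: K_def\<close>)
  obtain V where V: "0 \<le> V" "\<And>x. x \<in> X \<Longrightarrow> (\<integral>\<^sup>+\<omega>. ennreal ((dual_norm N (G x \<omega>))\<^sup>2) \<partial>P) \<le> ennreal (V\<^sup>2)"
    using ii by blast
  \<comment> \<open>A measurable null set covering the irregular samples; on it the oracle will be
    set to 0.\<close>
  obtain Z where Z: "{\<omega> \<in> space P. \<not> C1_with_gradient_on X (\<lambda>x. F x \<omega>) (\<lambda>x. G x \<omega>)} \<subseteq> Z" "Z \<in> null_sets P"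
    using i by (auto elim!: AE_E simp: null_sets_def)
  have Z_meas [measurable]: "Z \<in> sets P" using Z by auto
  have regular: "C1_with_gradient_on X (\<lambda>x. F x \<omega>) (\<lambda>x. G x \<omega>)" if "\<omega> \<in> space P" "\<omega> \<notin> Z" for \<omega>
    using Z that by blast
  have closed_X: "closed X" using X by (simp add: compact_imp_closed)
  let ?c = "closest_point X"
  have c_in: "?c x \<in> X" for x by (rule closest_point_in_set[OF closed_X X(1)])
  \<comment> \<open>A version of the gradient that is continuous in \<open>x\<close> for every sample and on the whole space.\<close>
  define \<Gamma> where "\<Gamma> x \<omega> = (if \<omega> \<in> Z then 0 else Riesz (G (?c x) \<omega>))" for x \<omega>
  interpret continuous_oracle P \<Gamma> "b * V"
  proof
    show "0 \<le> b * V" using b V by simp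
    fix x
    have [measurable]: "G (?c x) \<in> borel_measurable P" by (rule G_measurable[OF c_in])
    have [measurable]: "(Riesz :: ('v \<Rightarrow>\<^sub>L real) \<Rightarrow> 'v) \<in> borel_measurable borel"
      by (rule borel_measurable_continuous_onI[OF continuous_on_Riesz])
    show \<Gamma>_meas [measurable]: "\<Gamma> x \<in> borel_measurable P" unfolding \<Gamma>_def[abs_def] by measurable
    \<comment> \<open>Division by \<open>b^2\<close> leaves the dual norm in a mere comparison of
      integrals; the constant is then extracted from the integral of \<Gamma>, whose measurability
      has been proved.\<close>
    have "(norm (\<Gamma> x \<omega>))\<^sup>2 / b\<^sup>2 \<le> (dual_norm N (G (?c x) \<omega>))\<^sup>2" for \<omega>
    proof -
      have "norm (\<Gamma> x \<omega>) \<le> norm (G (?c x) \<omega>)" by (simp add: \<Gamma>_def norm_Riesz)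
      also have "\<dots> \<le> b * dual_norm N (G (?c x) \<omega>)" by (rule norm_le_dual_norm[OF norm_N a b])
      finally have "(norm (\<Gamma> x \<omega>))\<^sup>2 \<le> (b * dual_norm N (G (?c x) \<omega>))\<^sup>2" by (intro power_mono) auto
      then show ?thesis using b(1) by (simp add: power_mult_distrib field_simps)
    qed
    then have le: "(\<integral>\<^sup>+\<omega>. ennreal ((norm (\<Gamma> x \<omega>))\<^sup>2 / b\<^sup>2) \<partial>P) \<le> ennreal (V\<^sup>2)"
      by (intro order_trans[OF nn_integral_mono V(2)[OF c_in[of x]]] ennreal_leI)
    have "(\<integral>\<^sup>+\<omega>. ennreal ((norm (\<Gamma> x \<omega>))\<^sup>2) \<partial>P) = (\<integral>\<^sup>+\<omega>. ennreal (b\<^sup>2) * ennreal ((norm (\<Gamma> x \<omega>))\<^sup>2 / b\<^sup>2) \<partial>P)"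
      using b(1) by (intro nn_integral_cong) (simp flip: ennreal_mult')
    also have "\<dots> = ennreal (b\<^sup>2) * (\<integral>\<^sup>+\<omega>. ennreal ((norm (\<Gamma> x \<omega>))\<^sup>2 / b\<^sup>2) \<partial>P)"
      by (rule nn_integral_cmult) measurable
    also have "\<dots> \<le> ennreal (b\<^sup>2) * ennreal (V\<^sup>2)" by (intro mult_left_mono le) simp
    also have "\<dots> = ennreal ((b * V)\<^sup>2)" by (simp add: power_mult_distrib flip: ennreal_mult')
    finally show "(\<integral>\<^sup>+\<omega>. ennreal ((norm (\<Gamma> x \<omega>))\<^sup>2) \<partial>P) \<le> ennreal ((b * V)\<^sup>2)" .
  next
    fix \<omega> assume \<omega>: "\<omega> \<in> space P"
    show "continuous_on UNIV (\<lambda>x. \<Gamma> x \<omega>)"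
    proof (cases "\<omega> \<in> Z")
      case False
      have "continuous_on X (\<lambda>x. G x \<omega>)"
        using regular[OF \<omega> False] by (simp add: C1_with_gradient_on_def)
      then have "continuous_on UNIV (\<lambda>x. G (?c x) \<omega>)"
        by (rule continuous_on_compose2[OF _ continuous_on_closest_point[OF X(3) closed_X X(1)]])
          (use c_in in auto)
      then have "continuous_on UNIV (\<lambda>x. Riesz (G (?c x) \<omega>))"
        by (rule continuous_on_compose2[OF continuous_on_Riesz[of UNIV]]) auto
      with False show ?thesis by (simp add: \<Gamma>_def)
    qed (simp add: \<Gamma>_def)
  qed
  have \<Gamma>_X: "\<Gamma> x \<omega> = Riesz (G x \<omega>)" if "x \<in> X" "\<omega> \<notin> Z" for x \<omega>
    using that by (simp add: \<Gamma>_def closest_point_self)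
  have AE_Z: "AE \<omega> in P. \<omega> \<notin> Z" by (rule AE_not_in[OF Z(2)])
  have f_deriv: "(f has_derivative (\<lambda>v. g x \<bullet> v)) (at x within X)" if "x \<in> X" for x
  proof (rule expectation_has_derivative[where F = F, OF X(3) that F_integrable f_def])
    show "AE \<omega> in P. \<forall>x\<in>X. ((\<lambda>x. F x \<omega>) has_derivative (\<lambda>v. \<Gamma> x \<omega> \<bullet> v)) (at x within X)"
      using AE_Z AE_space
    proof eventually_elim
      case (elim \<omega>)
      then show ?case using regular[of \<omega>]
        by (auto simp: \<Gamma>_X C1_with_gradient_on_def Riesz_inner)
    qed
  qed
  have g_frechet: "frechet_derivative f (at x within X) (x - c) = g x \<bullet> (x - c)"
    if "x \<in> X" "c \<in> X" for x c
  proof (rule has_derivative_within_convex_unique[OF _ f_deriv[OF that(1)] X(3) that])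
    show "(f has_derivative frechet_derivative f (at x within X)) (at x within X)"
      using differentiableI[OF f_deriv[OF that(1)]] by (simp only: frechet_derivative_works)
  qed
  obtain U0 c0 where C: "C \<noteq> {}" "C \<subseteq> X" "closed C"
    and U0: "openin (top_of_set X) U0" "C \<subseteq> U0"
    and U0_ge: "\<And>x c. x \<in> U0 \<Longrightarrow> c \<in> C \<Longrightarrow> 0 \<le> frechet_derivative f (at x within X) (x - c)"
    and c0: "c0 \<in> C" "\<And>x. x \<in> U0 \<Longrightarrow> frechet_derivative f (at x within X) (x - c0) = 0 \<Longrightarrow> x \<in> C"
    using coherent unfolding locally_coherent_def closed_set_of_local_minimizers_def by blast
  obtain T where T: "open T" "U0 = X \<inter> T" using U0(1) by (auto simp: openin_open)
  have "compact C" using C X(2) compact_Int_closed[of X C] by (simp add: Int_absorb1)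
  \<comment> \<open>Compactness of \<open>C\<close> provides a uniform closed tube inside the region
    of coherence.\<close>
  then obtain r where r: "r > 0" "{x. infdist x C \<le> r} \<subseteq> T"
    using compact_in_open_separated[OF C(1) _ T(1), of thesis] U0(2) T(2) by auto
  have near_U0: "x \<in> U0" if "x \<in> X" "infdist x C \<le> r" for x
    using that r(2) T(2) by blast
  define Q where "Q = (\<lambda>z. mirror_map X h (blinfun_inner_right z))"
  have Q_eq: "Q z = mirror_map X h (blinfun_inner_right z)" for z by (simp add: Q_def)
  have linear_inner_right: "linear (blinfun_inner_right :: 'v \<Rightarrow> 'v \<Rightarrow>\<^sub>L real)"
    by (rule bounded_linear.linear[OF bounded_linear_blinfun_inner_right])
  define \<Phi> where "\<Phi> = (\<lambda>p z. Fenchel_coupling X h p (blinfun_inner_right z))"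
  have geometry: "coherent_mirror_geometry X C Q \<Phi> K g r c0"
  proof
    fix p z v
    show "\<Phi> p (z + v) \<le> \<Phi> p z + v \<bullet> (Q z - p) + (norm v)\<^sup>2 / (2 * K)"
      using Fenchel_coupling_step[of p "blinfun_inner_right z" "blinfun_inner_right v"]
      by (simp add: \<Phi>_def Q_def norm_inner_right linear_add[OF linear_inner_right])
  next
    fix x c assume x: "x \<in> X" "infdist x C \<le> r" and c: "c \<in> C"
    then have "c \<in> X" using C(2) by blast
    with U0_ge[OF near_U0[OF x] c] show "0 \<le> g x \<bullet> (x - c)" by (simp only: g_frechet[OF x(1)])
  next
    fix x assume x: "x \<in> X" "infdist x C \<le> r" "g x \<bullet> (x - c0) = 0"
    have "c0 \<in> X" using C(2) c0(1) by blast
    with x(3) show "x \<in> C" by (intro c0(2) near_U0 x(1,2)) (simp only: g_frechet[OF x(1)])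
  next
    fix p z assume "p \<in> X"
    then show "K / 2 * (norm (Q z - p))\<^sup>2 \<le> \<Phi> p z"
      unfolding Q_def \<Phi>_def by (rule Fenchel_coupling_ge)
  next
    fix p and z :: "nat \<Rightarrow> 'v" assume "p \<in> X" "(\<lambda>n. Q (z n)) \<longlonglongrightarrow> p"
    then show "(\<lambda>n. \<Phi> p (z n)) \<longlonglongrightarrow> 0"
      unfolding Q_def \<Phi>_def by (rule iii)
  next
    show "continuous_on X g" by (rule continuous_on_subset[OF continuous_on_g]) simp
  qed (use X K_pos C c0 r mirror_map_in in \<open>auto simp: Q_def\<close>)
  then interpret geo: coherent_mirror_geometry X C Q \<Phi> K g r c0 .
  have "continuous_on UNIV Q"
    unfolding Q_def
    by (rule continuous_on_compose2[OF continuous_on_mirror_map[of UNIV]])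
      (auto intro: bounded_linear.continuous_on[OF bounded_linear_blinfun_inner_right] continuous_intros)
  then have Q_meas: "Q \<in> borel_measurable borel" by (rule borel_measurable_continuous_onI)
  obtain R where R: "\<And>x. x \<in> X \<Longrightarrow> norm x \<le> R"
    using compact_imp_bounded[OF X(2)] by (auto simp: bounded_iff)
  have "K * r\<^sup>2 / 4 > 0" using K_pos r(1) by simp
  from geo.\<Phi>_small_near[OF this]
  \<comment> \<open>The radius depends on the geometry alone and is fixed before \<delta>, the step
    sizes and the probability space are introduced.\<close>
  obtain d where d: "d > 0" "\<And>z. infdist (Q z) C < d \<Longrightarrow> \<exists>p\<in>C. \<Phi> p z < K * r\<^sup>2 / 4" by blast
  define B where "B = 16 * R\<^sup>2 * (b * V)\<^sup>2 / (K * r\<^sup>2 / 8)\<^sup>2 + (b * V)\<^sup>2 / (K\<^sup>2 * r\<^sup>2 / 4)"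
  have B: "0 \<le> B" unfolding B_def by (intro add_nonneg_nonneg divide_nonneg_nonneg) auto
  let ?U = "X \<inter> {x. infdist x C < d}"
  show ?thesis
  proof (intro exI[of _ ?U] conjI allI impI)
    have "open {x. infdist x C < d}" by (intro open_Collect_less continuous_intros)
    then show "openin (top_of_set X) ?U" by (auto simp: openin_open)
    show "C \<subseteq> ?U" using C(2) d(1) by auto
    fix \<delta> :: real assume \<delta>: "\<delta> > 0"
    show "\<exists>\<eta>>0. \<forall>(M :: 'm measure) w (\<gamma> :: nat \<Rightarrow> real) y1.
                prob_space M \<longrightarrow> iid_samples M P w \<longrightarrow>
                (\<forall>n. \<gamma> n > 0) \<longrightarrow> summable (\<lambda>n. (\<gamma> n)\<^sup>2) \<longrightarrow> \<not> summable \<gamma> \<longrightarrow>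
                (\<Sum>n. (\<gamma> n)\<^sup>2) \<le> \<eta> \<longrightarrow> mirror_map X h y1 \<in> ?U \<longrightarrow>
                1 - \<delta> \<le> measure (completion M) {m \<in> space M.
                     (\<lambda>n. norm_dist_to N C (smd_iterate X h G \<gamma> y1 (\<lambda>k. w k m) n)) \<longlonglongrightarrow> 0}"
    \<comment> \<open>\<open>B\<close> is the coefficient in the failure bound; adding 1 keeps the
      quotient meaningful when \<open>B\<close> is 0.\<close>
    proof (intro exI[of _ "\<delta> / (B + 1)"] conjI allI impI)
      show "0 < \<delta> / (B + 1)" using \<delta> B by simp
      fix M :: "'m measure" and w and \<gamma> :: "nat \<Rightarrow> real" and y1
      assume M: "prob_space M" "iid_samples M P w" and \<gamma>: "\<forall>n. 0 < \<gamma> n" "summable (\<lambda>n. (\<gamma> n)\<^sup>2)" "\<not> summable \<gamma>"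
        and small: "(\<Sum>n. (\<gamma> n)\<^sup>2) \<le> \<delta> / (B + 1)" and y1: "mirror_map X h y1 \<in> ?U"
      interpret M: prob_space M by (rule M)
      interpret smd: stochastic_mirror_descent M P w \<Gamma> "b * V" Q \<gamma> "Riesz y1"
        by unfold_locales (use M \<gamma> Q_meas in \<open>auto intro: less_imp_le\<close>)
      \<comment> \<open>The base point varies with \<open>y1\<close>, but the probability estimate
        is uniform over such points.\<close>
      obtain p where p: "p \<in> C" "\<Phi> p (Riesz y1) < K * r\<^sup>2 / 4"
        using d(2)[of "Riesz y1"] y1 by (auto simp: Q_def inner_right_Riesz)
      let ?A = "{m \<in> space M. (\<lambda>n. norm_dist_to N C (smd_iterate X h G \<gamma> y1 (\<lambda>k. w k m) n)) \<longlonglongrightarrow> 0}"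
      let ?E = "{m \<in> space M. (\<lambda>n. infdist (smd.x n m) C) \<longlonglongrightarrow> 0}"
      have E_meas: "?E \<in> sets M" by (rule smd.convergence_event_measurable)
      have "1 - B * (\<Sum>n. (\<gamma> n)\<^sup>2) \<le> M.prob ?E"
        unfolding B_def
        by (rule smd.prob_trajectory_converges[OF geometry _ _ R p]) (use \<gamma> in auto)
      moreover have "B * (\<Sum>n. (\<gamma> n)\<^sup>2) \<le> \<delta>"
      proof -
        have "B * (\<Sum>n. (\<gamma> n)\<^sup>2) \<le> B * (\<delta> / (B + 1))" using small B by (rule mult_left_mono)
        also have "\<dots> \<le> \<delta>" using B \<delta> by (simp add: field_simps)
        finally show ?thesis .
      qed
      \<comment> \<open>The events can differ only where some sample hits \<open>Z\<close>.
        Measurability in \<open>M\<close> is established for \<open>?E\<close>; for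
        \<open>?A\<close> it follows in the completion from almost sure equality.\<close>
      moreover have "measure (completion M) ?A = M.prob ?E"
      proof -
        have "AE m in M. w k m \<notin> Z" for k
          by (rule AE_distrD[OF smd.w_measurable]) (unfold smd.w_law, rule AE_Z)
        then have "AE m in M. \<forall>k. w k m \<notin> Z" by (simp add: AE_all_countable)
        then have "AE m in M. m \<in> ?E \<longleftrightarrow> m \<in> ?A"
        proof (rule AE_mp, intro AE_I2 impI)
          fix m assume m: "m \<in> space M" "\<forall>k. w k m \<notin> Z"
          have "smd_dual X h G \<gamma> y1 (\<lambda>k. w k m) n = blinfun_inner_right (smd.Y n m)" for n
          proof (induction n)
            case (Suc n)
            have "\<Gamma> (Q (smd.Y n m)) (w n m) = Riesz (G (Q (smd.Y n m)) (w n m))"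
              using m by (intro \<Gamma>_X geo.Q_in) auto
            then have "blinfun_inner_right (\<Gamma> (Q (smd.Y n m)) (w n m)) = G (Q (smd.Y n m)) (w n m)"
              by (simp add: inner_right_Riesz)
            then show ?case
              by (simp only: smd_dual.simps Suc Q_eq[symmetric] smd.Y_Suc smd.G_def smd.x_def
                  linear_diff[OF linear_inner_right] linear_cmul[OF linear_inner_right])
          qed (simp add: smd.Y_0 inner_right_Riesz)
          then have "smd_iterate X h G \<gamma> y1 (\<lambda>k. w k m) n = smd.x n m" for n
            by (simp only: smd_iterate_def smd.x_def Q_eq)
          then show "m \<in> ?E \<longleftrightarrow> m \<in> ?A"
            using norm_dist_to_tendsto_0_iff[OF a b C(1,3)] m by simp
        qed
        then have AE_eq: "AE m in completion M. m \<in> ?E \<longleftrightarrow> m \<in> ?A" by (rule AE_completion)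
        have "?A \<in> sets (completion M)"
          by (rule completion.in_sets_AE[OF AE_eq]) (use E_meas in auto)
        then have "measure (completion M) ?A = measure (completion M) ?E"
          using E_meas AE_eq by (intro measure_eq_AE) auto
        then show ?thesis using E_meas by simp
      qed
      ultimately show "1 - \<delta> \<le> measure (completion M) ?A" by linarith
    qed
  qed
qed

end
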